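(* Let $\mathbf{X}$ be an isotropic unimodal Lévy process on $\mathbb{R}^d$ with Lévy–Khintchine exponent $\psi\in\Pi^\infty_\ell$ for some bounded $\ell\in\mathcal{R}^\infty_0$. Then there exist $r_0,t_0>0$ and $C\ge1$ such that for all $t\in(0,t_0)$ and $0<|x|\le r_0$, \[ C^{-1}\,t|x|^{-d}\ell(|x|^{-1})e^{-t\psi(|x|^{-1})}\le p(t,x)\le C\,t|x|^{-d}\ell(|x|^{-1})e^{-t\psi(|x|^{-1})}. \]
   Context: An isotropic unimodal Lévy process on $\mathbb{R}^d$ is a pure-jump Lévy process $\mathbf{X}=(X_t)_{t\ge0}$, $X_0=0$, with $\mathbb{E}e^{i\langle\xi,X_t\rangle}=e^{-t\psi(\xi)}$, $\psi(\xi)=\int_{\mathbb{R}^d}(1-\cos\langle\xi,x\rangle)\,\nu(\mathrm{d}x)$, where the Lévy measure has a radial, radially non-increasing density; for $t>0$ the law of $X_t$ on $\mathbb{R}^d\setminus\{0\}$ has a radial non-increasing density $p(t,x)$. Radial functions are written as functions of $|x|$. $\ell\in\mathcal{R}^\infty_0$ means $\ell$ positive on some $[a,\infty)$ with $\ell(\lambda x)/\ell(x)\to1$ as $x\to\infty$ for all $\lambda>0$; $\Pi^\infty_\ell$ is the set of $f:[a,\infty)\to[0,\infty)$ with $\lim_{x\to\infty}(f(\lambda x)-f(x))/\ell(x)=\log\lambda$ for all $\lambda>0$. *)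

theory Defs
  imports "HOL-Probability.Probability"
begin

definition levy_process :: "'b measure \<Rightarrow> (real \<Rightarrow> 'b \<Rightarrow> 'a::euclidean_space) \<Rightarrow> bool" where
  "levy_process M X \<longleftrightarrow>
     prob_space M \<and>
     (\<forall>t\<ge>0. X t \<in> borel_measurable M) \<and>
     (AE \<omega> in M. X 0 \<omega> = 0) \<and>
     (\<forall>(ts::nat \<Rightarrow> real) n. 0 \<le> ts 0 \<and> (\<forall>i<n. ts i \<le> ts (Suc i)) \<longrightarrow>
        prob_space.indep_vars M (\<lambda>_. borel) (\<lambda>i \<omega>. X (ts (Suc i)) \<omega> - X (ts i) \<omega>) {..<n}) \<and>
     (\<forall>s t. 0 \<le> s \<and> 0 \<le> t \<longrightarrow>
        distr M borel (\<lambda>\<omega>. X (s + t) \<omega> - X s \<omega>) = distr M borel (X t)) \<and>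
     (\<forall>t\<ge>0. \<forall>\<epsilon>>0.
        ((\<lambda>s. measure M {\<omega>\<in>space M. \<epsilon> \<le> norm (X s \<omega> - X t \<omega>)}) \<longlongrightarrow> 0) (at t within {0..})) \<and>
     (AE \<omega> in M. \<forall>t\<ge>0. ((\<lambda>s. X s \<omega>) \<longlongrightarrow> X t \<omega>) (at_right t) \<and>
                          (t > 0 \<longrightarrow> (\<exists>l. ((\<lambda>s. X s \<omega>) \<longlongrightarrow> l) (at_left t))))"

definition isotropic_unimodal_levy ::
  "'b measure \<Rightarrow> (real \<Rightarrow> 'b \<Rightarrow> 'a::euclidean_space) \<Rightarrow> (real \<Rightarrow> real)
    \<Rightarrow> ('a \<Rightarrow> real) \<Rightarrow> (real \<Rightarrow> 'a \<Rightarrow> real) \<Rightarrow> bool" where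
  "isotropic_unimodal_levy M X g psi p \<longleftrightarrow>
     levy_process M X \<and>
     \<comment> \<open>Levy measure nu(dx) = g(|x|) dx, radial, radially non-increasing\<close>
     (\<forall>r. 0 \<le> g r) \<and>
     (\<forall>r s. 0 < r \<and> r \<le> s \<longrightarrow> g s \<le> g r) \<and>
     integrable lborel (\<lambda>x::'a. min 1 ((norm x)\<^sup>2) * g (norm x)) \<and>
     \<comment> \<open>Levy-Khintchine exponent (pure jump, symmetric)\<close>
     (\<forall>\<xi>. psi \<xi> = (\<integral>x. (1 - cos (\<xi> \<bullet> x)) * g (norm x) \<partial>lborel)) \<and>
     (\<forall>t\<ge>0. \<forall>\<xi>. (\<integral>\<omega>. cis (\<xi> \<bullet> X t \<omega>) \<partial>M) = complex_of_real (exp (- (t * psi \<xi>)))) \<and>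
     \<comment> \<open>p t is the density of the law of X t on R^d minus the origin, radial non-increasing\<close>
     (\<forall>t>0. p t \<in> borel_measurable borel \<and> (\<forall>x. 0 \<le> p t x) \<and>
        (\<forall>A\<in>sets borel. emeasure (distr M borel (X t)) (A - {0})
                          = (\<integral>\<^sup>+x\<in>A - {0}. ennreal (p t x) \<partial>lborel)) \<and>
        (\<forall>x y. x \<noteq> 0 \<and> norm x \<le> norm y \<longrightarrow> p t y \<le> p t x))"

definition radial :: "('a::euclidean_space \<Rightarrow> real) \<Rightarrow> real \<Rightarrow> real" where
  "radial f r = f (r *\<^sub>R (SOME e::'a. norm e = 1))"

definition slowly_varying_inf :: "(real \<Rightarrow> real) \<Rightarrow> bool" where
  "slowly_varying_inf l \<longleftrightarrow> (\<exists>a. \<forall>x\<ge>a. 0 < l x) \<and>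
     (\<forall>c>0. ((\<lambda>x. l (c * x) / l x) \<longlongrightarrow> 1) at_top)"

definition deHaan_inf :: "(real \<Rightarrow> real) \<Rightarrow> (real \<Rightarrow> real) \<Rightarrow> bool" where
  "deHaan_inf l f \<longleftrightarrow> (\<exists>a. \<forall>x\<ge>a. 0 \<le> f x) \<and>
     (\<forall>c>0. ((\<lambda>x. (f (c * x) - f x) / l x) \<longlongrightarrow> ln c) at_top)"

end

theory Submission
  imports Defs
begin

text \<open>
  Write \<open>f\<close> for the radial profile of \<open>psi\<close> and \<open>h u = exp (- u\<^sup>2 / 2) - exp (- 2 u\<^sup>2)\<close>. If \<open>Z\<close> is a
  standard Gaussian vector, Fubini's theorem gives
  \<open>E h (R |X_t|) = E (exp (- t f (R |Z|)) - exp (- t f (2 R |Z|)))\<close>, and since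
  \<open>f (2 R z) - f (R z)\<close> is asymptotic to \<open>l R ln 2\<close>, dominated convergence with Potter-type bounds
  shows that this is asymptotic to \<open>ln 2 \<cdot> t l(R) exp (- t f R)\<close> as \<open>t \<rightarrow> 0\<close> and \<open>R \<rightarrow> \<infinity>\<close> jointly.
  The window \<open>h\<close> is bounded below on \<open>[1/2, 1]\<close>, which with monotonicity of \<open>p t\<close> gives the upper
  bound. For the lower bound, \<open>h u\<close> is a small multiple of \<open>h (16 u)\<close> for \<open>u \<le> 1/16\<close> and of
  \<open>h (u / 4)\<close> for \<open>u \<ge> 16\<close>; by the asymptotics at the scales \<open>16 R\<close> and \<open>R / 4\<close> a fixed
  proportion of \<open>E h (R |X_t|)\<close> therefore comes from \<open>1/16 \<le> R |X_t| \<le> 16\<close>.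
\<close>

section \<open>Rotation invariance\<close>

text \<open>Fourier inversion is out of reach for small \<open>t\<close>: \<open>l\<close> is
  bounded, so \<open>psi\<close> grows at most logarithmically and \<open>exp (- t psi)\<close> is
  not integrable. Gaussian averages need only the characteristic function. A difference of two
  Gaussians is used because it vanishes at the origin, where \<open>X t\<close> may have an atom.
  The constants must not depend on \<open>t\<close>, although \<open>t f R\<close> may tend to
  infinity or fail to converge; after division by \<open>exp (- t f R)\<close> only the increments
  \<open>t (f (R z) - f R)\<close> remain, and they tend to 0 because \<open>t l R\<close> does. No
  measurability of \<open>l\<close> is given, so \<open>l\<close> is controlled through increments
  of \<open>f\<close>, which is continuous.\<close>

lemma lborel_distr_affine_sign:
  fixes c :: "'a::euclidean_space"
  assumes "s = 1 \<or> s = -1"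
  shows "distr lborel borel (\<lambda>x. c + s *\<^sub>R x) = lborel"
  using lborel_affine[of s c] assms by (auto simp: density_1)

text \<open>The Fubini argument for the uniqueness of Haar measure, applied to Lebesgue measure and its
  image under \<open>T\<close>; the two agree on the unit ball.\<close>

lemma lborel_distr_isometric_involution:
  fixes T :: "'a::euclidean_space \<Rightarrow> 'a"
  assumes lin: "linear T" and iso: "\<And>x. norm (T x) = norm x" and inv: "\<And>x. T (T x) = x"
  shows "distr lborel borel T = lborel"
proof (rule measure_eqI)
  show "sets (distr lborel borel T) = sets (lborel :: 'a measure)" by simp
  fix A assume "A \<in> sets (distr lborel borel T)"
  then have A[measurable]: "A \<in> sets borel" by simp
  have T[measurable]: "T \<in> borel_measurable borel"
    using lin by (intro borel_measurable_continuous_onI linear_continuous_on linear_conv_bounded_linear[THEN iffD1])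
  define N where "N = distr lborel borel T"
  have setsN[measurable_cong]: "sets N = sets borel" by (simp add: N_def)
  \<comment> \<open>The involution moves a translation from outside \<open>T\<close> to inside,
    \<open>T x + c = T (T c + x)\<close>, where Lebesgue measure absorbs it.\<close>
  have shift: "distr N borel (\<lambda>x. x + c) = N" for c
  proof -
    have "distr N borel (\<lambda>x. x + c) = distr lborel borel (\<lambda>x. T x + c)"
      by (simp add: N_def distr_distr o_def)
    also have "(\<lambda>x. T x + c) = (\<lambda>x. T (T c + 1 *\<^sub>R x))"
      using linear_add[OF lin] inv by (auto simp: add.commute)
    also have "distr lborel borel (\<lambda>x. T (T c + 1 *\<^sub>R x)) = distr (distr lborel borel (\<lambda>x. T c + 1 *\<^sub>R x)) borel T"
      by (subst distr_distr) (simp_all add: o_def)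
    also have "\<dots> = N"
      by (subst lborel_distr_affine_sign) (simp_all add: N_def)
    finally show ?thesis .
  qed
  define B where "B = cball (0::'a) 1"
  have B[measurable]: "B \<in> sets borel" by (simp add: B_def)
  have NB: "emeasure N B = emeasure lborel B"
    unfolding N_def B_def by (subst emeasure_distr) (auto simp: iso intro!: arg_cong2[where f=emeasure])
  have lB: "emeasure lborel B \<noteq> 0" "emeasure lborel B \<noteq> \<infinity>"
    unfolding B_def by (simp_all add: emeasure_cball less_imp_neq[OF unit_ball_vol_pos, symmetric])
  interpret N: sigma_finite_measure N
  proof
    show "\<exists>F. countable F \<and> F \<subseteq> sets N \<and> \<Union>F = space N \<and> (\<forall>a\<in>F. emeasure N a \<noteq> \<infinity>)"
    proof (intro exI[of _ "range (\<lambda>n. cball 0 (real n))"] conjI ballI)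
      show "\<Union>(range (\<lambda>n. cball (0::'a) (real n))) = space N"
        by (auto simp: N_def real_arch_simple)
      fix a assume "a \<in> range (\<lambda>n. cball (0::'a) (real n))"
      then obtain n where "a = cball 0 (real n)" by auto
      moreover have "emeasure N (cball 0 (real n)) = emeasure lborel (cball (0::'a) (real n))"
        unfolding N_def by (subst emeasure_distr) (auto simp: iso intro!: arg_cong2[where f=emeasure])
      ultimately show "emeasure N a \<noteq> \<infinity>" by (simp add: emeasure_cball)
    qed (auto simp: setsN)
  qed
  interpret P: pair_sigma_finite "lborel :: 'a measure" N ..
  \<comment> \<open>The integral of \<open>indicator A x * indicator B (x + y)\<close> is computed
    twice: directly over \<open>y\<close>, and after replacing \<open>x\<close> by
    \<open>x - y\<close> under \<open>N\<close>, where the integral over \<open>y\<close> sees a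
    reflected translate of \<open>A\<close>.\<close>
  have "emeasure N A * emeasure lborel B = (\<integral>\<^sup>+x. indicator A x * emeasure lborel B \<partial>N)"
    by (subst nn_integral_multc) simp_all
  also have "\<dots> = (\<integral>\<^sup>+x. (\<integral>\<^sup>+y. indicator A x * indicator B (x + y) \<partial>lborel) \<partial>N)"
  proof (rule nn_integral_cong)
    fix x
    have "emeasure lborel B = emeasure (distr lborel borel (\<lambda>y. x + 1 *\<^sub>R y)) B"
      by (subst lborel_distr_affine_sign) simp_all
    also have "\<dots> = (\<integral>\<^sup>+y. indicator B (x + y) \<partial>lborel)"
      by (subst nn_integral_indicator[symmetric], simp, subst nn_integral_distr) simp_all
    finally show "indicator A x * emeasure lborel B = (\<integral>\<^sup>+y. indicator A x * indicator B (x + y) \<partial>lborel)"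
      by (simp add: nn_integral_cmult)
  qed
  also have "\<dots> = (\<integral>\<^sup>+y. (\<integral>\<^sup>+x. indicator A x * indicator B (x + y) \<partial>N) \<partial>lborel)"
    by (rule P.Fubini') measurable
  also have "\<dots> = (\<integral>\<^sup>+y. (\<integral>\<^sup>+x. indicator A (x - y) * indicator B x \<partial>N) \<partial>lborel)"
  proof (rule nn_integral_cong)
    fix y
    show "(\<integral>\<^sup>+x. indicator A x * indicator B (x + y) \<partial>N) = (\<integral>\<^sup>+x. indicator A (x - y) * indicator B x \<partial>N)"
      by (subst (2) shift[symmetric, of y], subst nn_integral_distr) simp_all
  qed
  also have "\<dots> = (\<integral>\<^sup>+x. (\<integral>\<^sup>+y. indicator A (x - y) * indicator B x \<partial>lborel) \<partial>N)"
    by (rule P.Fubini'[symmetric]) measurable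
  also have "\<dots> = (\<integral>\<^sup>+x. emeasure lborel A * indicator B x \<partial>N)"
  proof (rule nn_integral_cong)
    fix x
    have "emeasure lborel A = emeasure (distr lborel borel (\<lambda>y. x + (-1) *\<^sub>R y)) A"
      by (subst lborel_distr_affine_sign) simp_all
    also have "\<dots> = (\<integral>\<^sup>+y. indicator A (x - y) \<partial>lborel)"
      by (subst nn_integral_indicator[symmetric], simp, subst nn_integral_distr) simp_all
    finally show "(\<integral>\<^sup>+y. indicator A (x - y) * indicator B x \<partial>lborel) = emeasure lborel A * indicator B x"
      by (simp add: nn_integral_multc)
  qed
  also have "\<dots> = emeasure lborel A * emeasure lborel B"
    by (simp add: nn_integral_cmult NB)
  finally have "emeasure lborel B * emeasure N A = emeasure lborel B * emeasure lborel A"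
    by (simp add: mult.commute)
  then show "emeasure (distr lborel borel T) A = emeasure lborel A"
    using lB by (simp add: ennreal_mult_cancel_left N_def)
qed

text \<open>Householder reflection in the hyperplane orthogonal to \<open>a - b\<close>. It is its
  own inverse, so it falls under the change of variables for isometric involutions.\<close>

lemma reflection_exists:
  fixes a b :: "'a::euclidean_space"
  assumes "norm a = norm b"
  obtains T where "linear T" "\<And>x y. T x \<bullet> T y = x \<bullet> y" "\<And>x. T (T x) = x" "T a = b"
proof (cases "a = b")
  case True
  then show ?thesis using that[of "\<lambda>x. x"] by (simp add: linear_id[unfolded id_def])
next
  case False
  define v where "v = a - b"
  have v: "v \<bullet> v > 0" using False by (simp add: v_def)
  define T where "T = (\<lambda>x. x - (2 * (v \<bullet> x) / (v \<bullet> v)) *\<^sub>R v)"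
  show ?thesis
  proof (rule that)
    show "linear T" unfolding T_def
      by (intro linearI) (simp_all add: algebra_simps add_divide_distrib)
    show "T x \<bullet> T y = x \<bullet> y" for x y
      using v by (simp add: T_def inner_diff_left inner_diff_right inner_commute field_simps)
    show "T (T x) = x" for x
      using v by (simp add: T_def inner_diff_right algebra_simps flip: scaleR_add_left scaleR_diff_left)
    have "a \<bullet> a = b \<bullet> b" using assms by (metis dot_square_norm)
    then have "2 * (v \<bullet> a) = v \<bullet> v"
      by (simp add: v_def inner_diff_left inner_diff_right inner_commute)
    then show "T a = b" using v by (simp add: T_def) (simp add: v_def)
  qed
qed

text \<open>\<open>radial\<close> evaluates along one arbitrarily chosen unit vector. A reflection
  sending \<open>\<xi>\<close> to the multiple of that vector of the same length preserves both
  Lebesgue measure and \<open>g (norm x)\<close>, hence the integral.\<close>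

lemma radial_exponent:
  fixes g :: "real \<Rightarrow> real" and psi :: "'a::euclidean_space \<Rightarrow> real"
  assumes int: "integrable lborel (\<lambda>x::'a. min 1 ((norm x)\<^sup>2) * g (norm x))"
    and psi: "\<And>\<xi>. psi \<xi> = (\<integral>x. (1 - cos (\<xi> \<bullet> x)) * g (norm x) \<partial>lborel)"
  shows "psi \<xi> = radial psi (norm \<xi>)"
proof -
  define e :: 'a where "e = (SOME e::'a. norm e = 1)"
  have e: "norm e = 1" unfolding e_def by (rule someI_ex) (meson norm_Basis SOME_Basis)
  obtain T where T: "linear T" "\<And>x y. T x \<bullet> T y = x \<bullet> y" "\<And>x. T (T x) = x" "T \<xi> = norm \<xi> *\<^sub>R e"
    using reflection_exists[of \<xi> "norm \<xi> *\<^sub>R e"] e by auto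
  have nT: "norm (T x) = norm x" for x using T(2) by (simp add: norm_eq_sqrt_inner)
  have [measurable]: "T \<in> borel_measurable borel"
    using T(1) by (intro borel_measurable_continuous_onI linear_continuous_on linear_conv_bounded_linear[THEN iffD1])
  \<comment> \<open>Measurability of the integrand has to come from \<open>int\<close>: the weight
    \<open>min 1 ((norm x)^2)\<close> is divided out, and at 0 both sides vanish.\<close>
  have meas: "(\<lambda>x::'a. (1 - cos (\<eta> \<bullet> x)) * g (norm x)) \<in> borel_measurable borel" for \<eta>
  proof -
    have "(\<lambda>x::'a. (1 - cos (\<eta> \<bullet> x)) * g (norm x)) =
        (\<lambda>x. (1 - cos (\<eta> \<bullet> x)) / min 1 ((norm x)\<^sup>2) * (min 1 ((norm x)\<^sup>2) * g (norm x)))"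
    proof
      fix x :: 'a
      show "(1 - cos (\<eta> \<bullet> x)) * g (norm x) =
         (1 - cos (\<eta> \<bullet> x)) / min 1 ((norm x)\<^sup>2) * (min 1 ((norm x)\<^sup>2) * g (norm x))"
        by (cases "x = 0") (simp_all add: min_def)
    qed
    moreover have [measurable]: "(\<lambda>x::'a. min 1 ((norm x)\<^sup>2) * g (norm x)) \<in> borel_measurable borel"
      using int by (simp add: borel_measurable_integrable)
    ultimately show ?thesis by (simp only:) measurable
  qed
  have "radial psi (norm \<xi>) = psi (T \<xi>)" by (simp add: radial_def e_def T(4))
  also have "\<dots> = (\<integral>x. (1 - cos (T \<xi> \<bullet> x)) * g (norm x) \<partial>distr lborel borel T)"
    using lborel_distr_isometric_involution[OF T(1) nT T(3)] by (simp add: psi)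
  also have "\<dots> = (\<integral>x. (1 - cos (T \<xi> \<bullet> T x)) * g (norm (T x)) \<partial>lborel)"
    by (rule integral_distr[OF _ meas]) simp
  also have "\<dots> = psi \<xi>" by (simp add: T(2) nT psi)
  finally show ?thesis by simp
qed

section \<open>The standard Gaussian measure\<close>

text \<open>Encoded as the image of a product of one-dimensional normals, so that the characteristic
  function and the marginals can be computed coordinatewise, without a density on
  \<open>'a\<close>.\<close>

definition std_gaussian :: "'a::euclidean_space measure" where
  "std_gaussian = distr (Pi\<^sub>M Basis (\<lambda>_. std_normal_distribution)) borel (\<lambda>f. \<Sum>b\<in>Basis. f b *\<^sub>R b)"

lemma sets_std_gaussian [measurable_cong, simp]: "sets std_gaussian = sets borel"
  by (simp add: std_gaussian_def)

lemma space_std_gaussian [simp]: "space std_gaussian = UNIV"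
  by (simp add: std_gaussian_def)

lemma measurable_sum_basis [measurable]:
  "(\<lambda>f. \<Sum>b\<in>Basis. f b *\<^sub>R b) \<in> Pi\<^sub>M Basis (\<lambda>_. std_normal_distribution) \<rightarrow>\<^sub>M (borel :: 'a::euclidean_space measure)"
  by (intro borel_measurable_sum borel_measurable_scaleR borel_measurable_const) simp_all

lemma prob_space_std_normal: "prob_space std_normal_distribution"
  using real_dist_normal_dist by (simp add: real_distribution_def)

lemma prob_space_std_gaussian: "prob_space std_gaussian"
  unfolding std_gaussian_def
  by (intro prob_space.prob_space_distr prob_space_PiM prob_space_std_normal measurable_sum_basis)

lemma characteristic_std_gaussian:
  fixes x :: "'a::euclidean_space"
  shows "(\<integral>z. cis (x \<bullet> z) \<partial>std_gaussian) = complex_of_real (exp (- (norm x)\<^sup>2 / 2))"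
proof -
  interpret N: prob_space std_normal_distribution by (rule prob_space_std_normal)
  interpret P: product_sigma_finite "\<lambda>_::'a. std_normal_distribution" ..
  have "(\<integral>z. cis (x \<bullet> z) \<partial>std_gaussian) =
      (\<integral>f. cis (x \<bullet> (\<Sum>b\<in>Basis. f b *\<^sub>R b)) \<partial>Pi\<^sub>M Basis (\<lambda>_. std_normal_distribution))"
    unfolding std_gaussian_def
    by (rule integral_distr) (auto intro!: borel_measurable_continuous_onI continuous_intros)
  also have "\<dots> = (\<integral>f. (\<Prod>b\<in>Basis. iexp ((x \<bullet> b) * f b)) \<partial>Pi\<^sub>M Basis (\<lambda>_. std_normal_distribution))"
    by (intro Bochner_Integration.integral_cong refl)
      (simp add: inner_sum_right cis_conv_exp exp_sum[symmetric] sum_distrib_left mult_ac)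
  also have "\<dots> = (\<Prod>b\<in>Basis. \<integral>y. iexp ((x \<bullet> b) * y) \<partial>std_normal_distribution)"
  proof (rule P.product_integral_prod)
    fix b :: 'a
    show "integrable std_normal_distribution (\<lambda>y. iexp ((x \<bullet> b) * y))"
      by (rule N.integrable_iexp) simp_all
  qed simp
  also have "\<dots> = (\<Prod>b\<in>Basis. complex_of_real (exp (- ((x \<bullet> b)\<^sup>2) / 2)))"
    by (simp only: char_def[symmetric] char_std_normal_distribution)
  also have "\<dots> = complex_of_real (exp (- (norm x)\<^sup>2 / 2))"
    by (simp add: exp_sum[symmetric] sum_negf sum_divide_distrib[symmetric]
       power2_norm_eq_inner euclidean_inner[of x x] flip: of_real_prod power2_eq_square)
  finally show ?thesis .
qed

lemma std_gaussian_component: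
  fixes b :: "'a::euclidean_space"
  assumes b: "b \<in> Basis"
  shows "distr std_gaussian borel (\<lambda>z. z \<bullet> b) = std_normal_distribution"
proof -
  have "distr std_gaussian borel (\<lambda>z. z \<bullet> b) =
      distr (Pi\<^sub>M Basis (\<lambda>_::'a. std_normal_distribution)) borel (\<lambda>f. (\<Sum>b\<in>Basis. f b *\<^sub>R b) \<bullet> b)"
    unfolding std_gaussian_def by (subst distr_distr) (simp_all add: o_def)
  also have "\<dots> = distr (Pi\<^sub>M Basis (\<lambda>_::'a. std_normal_distribution)) std_normal_distribution (\<lambda>f. f b)"
    by (rule distr_cong) (simp_all add: inner_sum_left_Basis b)
  also have "\<dots> = std_normal_distribution"
    by (rule distr_PiM_component[OF prob_space_std_normal b])
  finally show ?thesis .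
qed

lemma integrable_std_gaussian_component:
  fixes b :: "'a::euclidean_space" and k :: "real \<Rightarrow> real"
  assumes b: "b \<in> Basis" and k: "integrable std_normal_distribution k"
  shows "integrable std_gaussian (\<lambda>z. k (z \<bullet> b))"
proof -
  have "k \<in> borel_measurable borel"
    using borel_measurable_integrable[OF k] by simp
  then show ?thesis
    using k by (subst (asm) std_gaussian_component[OF b, symmetric], subst (asm) integrable_distr_eq) simp_all
qed

text \<open>The exponent exceeds -1, so the singularity at 0 is integrable. The majorant is a power
  on each side of 0, plus the normal density itself where the power is at most 1.\<close>

lemma integrable_std_normal_inverse_sqrt:
  "integrable std_normal_distribution (\<lambda>x. \<bar>x\<bar> powr (-1/2))"
proof -
  have "(\<lambda>t::real. t powr (-1/2)) integrable_on {0..1}"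
    by (rule integrable_on_powr_from_0) auto
  hence "(\<lambda>t::real. t powr (-1/2)) absolutely_integrable_on {0..1}"
    by (subst absolutely_integrable_on_iff_nonneg) auto
  hence i1: "integrable lborel (\<lambda>t::real. indicator {0..1} t * t powr (-1/2))"
    unfolding set_integrable_def by (subst (asm) integrable_completion) auto
  hence i2: "integrable lborel (\<lambda>t::real. indicator {0..1} (0 + -1 * t) * (0 + -1 * t) powr (-1/2))"
    by (rule lborel_integrable_real_affine) simp
  have i3: "integrable lborel std_normal_density" by (rule integrable_normal_density) simp
  have "integrable lborel (\<lambda>x. std_normal_density x * \<bar>x\<bar> powr (-1/2))"
  proof (rule Bochner_Integration.integrable_bound[OF Bochner_Integration.integrable_add[OF Bochner_Integration.integrable_add[OF i1 i2] i3]])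
    show "AE x in lborel. norm (std_normal_density x * \<bar>x\<bar> powr (-1/2)) \<le>
       norm (indicator {0..1} x * x powr (-1/2) + indicator {0..1} (0 + -1 * x) * (0 + -1 * x) powr (-1/2) + std_normal_density x)"
    proof (rule AE_I2)
      fix x :: real
      have d1: "std_normal_density x \<le> 1"
      proof -
        have "std_normal_density x \<le> 1 / sqrt (2 * pi)"
          by (simp add: std_normal_density_def field_simps)
        also have "\<dots> \<le> 1" using pi_gt3 by simp
        finally show ?thesis .
      qed
      have "std_normal_density x * \<bar>x\<bar> powr (-1/2) \<le>
         indicator {0..1} x * x powr (-1/2) + indicator {0..1} (- x) * (- x) powr (-1/2) + std_normal_density x"
      proof (cases "\<bar>x\<bar> \<le> 1")
        case True
        have "std_normal_density x * \<bar>x\<bar> powr (-1/2) \<le> 1 * \<bar>x\<bar> powr (-1/2)"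
          by (intro mult_right_mono d1) simp
        also have "\<dots> \<le> indicator {0..1} x * x powr (-1/2) + indicator {0..1} (- x) * (- x) powr (-1/2)"
          using True by (auto simp: indicator_def)
        finally show ?thesis using normal_density_nonneg[of 0 1 x] by linarith
      next
        case False
        then have "\<bar>x\<bar> powr (-1/2) \<le> 1"
          using powr_mono[of "-1/2" 0 "\<bar>x\<bar>"] by (simp split: if_splits)
        then have "std_normal_density x * \<bar>x\<bar> powr (-1/2) \<le> std_normal_density x"
          by (simp add: mult_left_le)
        moreover have "0 \<le> indicator {0..1} x * x powr (-1/2) + indicator {0..1} (- x) * (- x) powr (-1/2)"
          by simp
        ultimately show ?thesis by linarith
      qed
      then show "norm (std_normal_density x * \<bar>x\<bar> powr (-1/2)) \<le>
       norm (indicator {0..1} x * x powr (-1/2) + indicator {0..1} (0 + -1 * x) * (0 + -1 * x) powr (-1/2) + std_normal_density x)"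
        by (simp add: abs_mult)
    qed
  qed simp
  then show ?thesis by (subst integrable_density) simp_all
qed

lemma AE_std_gaussian_nonzero:
  fixes b :: "'a::euclidean_space" assumes "b \<in> Basis"
  shows "AE z in std_gaussian. z \<bullet> b \<noteq> 0"
proof -
  have "AE x in std_normal_distribution. x \<noteq> 0"
    by (subst AE_density) (auto intro: AE_mp[OF AE_lborel_singleton[of 0]])
  then have "AE x in distr std_gaussian borel (\<lambda>z. z \<bullet> b). x \<noteq> 0"
    by (simp only: std_gaussian_component[OF assms])
  then show ?thesis by (subst (asm) AE_distr_iff) simp_all
qed

text \<open>Away from 0 this is the larger of \<open>norm z powr (1/2)\<close> and
  \<open>norm z powr (-1/2)\<close>, the majorant for dominated convergence. The exponent 1/2 is
  integrable even in dimension one: the negative power is controlled by the single coordinate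
  \<open>z \<bullet> b0\<close>.\<close>

lemma integrable_std_gaussian_dominant:
  "integrable std_gaussian (\<lambda>z::'a::euclidean_space. exp (\<bar>ln (norm z)\<bar> / 2))"
proof -
  interpret prob_space "std_gaussian :: 'a measure" by (rule prob_space_std_gaussian)
  obtain b0 :: 'a where b0: "b0 \<in> Basis" using SOME_Basis by blast
  have "integrable std_normal_distribution (\<lambda>x. \<bar>x\<bar>)"
    using integrable_std_normal_distribution_moment[of 1] by (intro integrable_abs) simp
  then have i1: "integrable std_gaussian (\<lambda>z::'a. 1 + (\<Sum>b\<in>Basis. \<bar>z \<bullet> b\<bar>) + \<bar>z \<bullet> b0\<bar> powr (-1/2))"
    using b0
    by (intro Bochner_Integration.integrable_add[OF Bochner_Integration.integrable_add[OF integrable_const]] Bochner_Integration.integrable_sum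
       integrable_std_gaussian_component integrable_std_normal_inverse_sqrt) simp_all
  show ?thesis
  proof (rule Bochner_Integration.integrable_bound[OF i1])
    show "AE z::'a in std_gaussian. norm (exp (\<bar>ln (norm z)\<bar> / 2)) \<le>
        norm (1 + (\<Sum>b\<in>Basis. \<bar>z \<bullet> b\<bar>) + \<bar>z \<bullet> b0\<bar> powr (-1/2))"
      using AE_std_gaussian_nonzero[OF b0]
    proof eventually_elim
      fix z :: 'a assume z: "z \<bullet> b0 \<noteq> 0"
      then have z0: "norm z > 0" by auto
      have s: "norm z \<le> (\<Sum>b\<in>Basis. \<bar>z \<bullet> b\<bar>)" by (rule norm_le_l1)
      have "exp (\<bar>ln (norm z)\<bar> / 2) \<le> 1 + norm z + \<bar>z \<bullet> b0\<bar> powr (-1/2)"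
      proof (cases "norm z \<ge> 1")
        case True
        then have "exp (\<bar>ln (norm z)\<bar> / 2) \<le> exp (ln (norm z))" by simp
        also have "\<dots> = norm z" using z0 by simp
        finally show ?thesis using powr_ge_zero[of "\<bar>z \<bullet> b0\<bar>" "-1/2"] by linarith
      next
        case False
        then have "exp (\<bar>ln (norm z)\<bar> / 2) = norm z powr (-1/2)" using z0 by (simp add: powr_def)
        also have "\<dots> \<le> \<bar>z \<bullet> b0\<bar> powr (-1/2)"
          using z z0 b0 by (intro powr_mono2') (auto intro: Basis_le_norm)
        finally show ?thesis using norm_ge_zero[of z] by linarith
      qed
      then show "norm (exp (\<bar>ln (norm z)\<bar> / 2)) \<le> norm (1 + (\<Sum>b\<in>Basis. \<bar>z \<bullet> b\<bar>) + \<bar>z \<bullet> b0\<bar> powr (-1/2))"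
        using s by simp
    qed
  qed simp
qed

section \<open>Potter-type bounds for the de Haan class\<close>

lemma eventually_at_top_shift:
  fixes P :: "real \<Rightarrow> bool"
  assumes "eventually P at_top"
  shows "eventually (\<lambda>u. P (u + c)) at_top"
  using assms
  by (rule eventually_compose_filterlim)
    (use filterlim_tendsto_add_at_top[OF tendsto_const[of c] filterlim_ident] in \<open>simp add: add.commute\<close>)

text \<open>Baire's theorem replaces the measure-theoretic uniform convergence theorem: continuity of
  \<open>F\<close> makes the sets on which the convergence is controlled closed, whatever \<open>L\<close> is.\<close>

lemma deHaan_local_bound:
  fixes F L :: "real \<Rightarrow> real"
  assumes cont: "continuous_on UNIV F"
    and pos: "eventually (\<lambda>u. 0 < L u) at_top"
    and sv: "\<And>v. ((\<lambda>u. L (u + v) / L u) \<longlongrightarrow> 1) at_top"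
    and dh: "\<And>v. ((\<lambda>u. (F (u + v) - F u) / L u) \<longlongrightarrow> v) at_top"
  shows "\<exists>C>0. eventually (\<lambda>u. \<forall>v\<in>{0..1}. \<bar>F (u + v) - F u\<bar> \<le> C * L u) at_top"
proof -
  obtain u1 where u1: "\<And>u. u \<ge> u1 \<Longrightarrow> 0 < L u"
    using pos by (auto simp: eventually_at_top_linorder)
  have two: "1 < (2::real)" by simp
  have dbl: "eventually (\<lambda>u. L (u + v) \<le> 2 * L u) at_top" for v
    using order_tendstoD(2)[OF sv[of v] two] pos
    by eventually_elim (auto simp: field_simps)
  \<comment> \<open>\<open>n\<close> records the threshold beyond which the bound holds. The
    constant 2 exceeds every limit \<open>v \<le> 1\<close>, so each \<open>v\<close> lies in some
    \<open>E n\<close>.\<close>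
  define E where "E n = {v\<in>{0..1}. \<forall>u\<ge>u1 + real n. \<bar>F (u + v) - F u\<bar> \<le> 2 * L u}" for n :: nat
  have cont': "continuous_on UNIV (\<lambda>v. F (u + v))" for u
    by (rule continuous_on_compose2[OF cont]) (auto intro!: continuous_intros)
  have clE: "closed (E n)" for n
  proof -
    have "E n = {0..1} \<inter> (\<Inter>u\<in>{u1 + real n..}. {v. \<bar>F (u + v) - F u\<bar> \<le> 2 * L u})"
      by (auto simp: E_def)
    moreover have "closed {v. \<bar>F (u + v) - F u\<bar> \<le> 2 * L u}" for u
      by (intro closed_Collect_le continuous_intros cont')
    ultimately show ?thesis by (simp add: closed_Int closed_INT)
  qed
  have cover: "(\<Union>n. E n) = {0..1}"
  proof (intro equalityI subsetI)
    fix v :: real assume v: "v \<in> {0..1}"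
    have "((\<lambda>u. \<bar>(F (u + v) - F u) / L u\<bar>) \<longlongrightarrow> \<bar>v\<bar>) at_top"
      by (intro tendsto_intros dh)
    then have "eventually (\<lambda>u. \<bar>(F (u + v) - F u) / L u\<bar> < 2) at_top"
      using v by (intro order_tendstoD(2)) auto
    then have "eventually (\<lambda>u. \<bar>F (u + v) - F u\<bar> \<le> 2 * L u) at_top"
      using pos by eventually_elim (simp add: field_simps)
    then obtain u2 where u2: "\<And>u. u \<ge> u2 \<Longrightarrow> \<bar>F (u + v) - F u\<bar> \<le> 2 * L u"
      by (auto simp: eventually_at_top_linorder)
    obtain n where "u2 - u1 \<le> real n" using real_arch_simple by blast
    then have "v \<in> E n" using v u2 by (auto simp: E_def)
    then show "v \<in> (\<Union>n. E n)" by blast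
  qed (auto simp: E_def)
  have "\<exists>n. interior (E n) \<noteq> {}"
  proof (rule ccontr)
    assume "\<not> ?thesis"
    then have "euclidean interior_of (\<Union>(range E)) = ({} :: real set)"
      using clE by (intro Baire_category_alt) (auto simp: completely_metrizable_space_euclidean)
    then show False by (simp add: cover)
  qed
  then obtain n x where "x \<in> interior (E n)" by blast
  then obtain e where e: "e > 0" "cball x e \<subseteq> E n" by (meson mem_interior_cball)
  \<comment> \<open>With base point \<open>u - x\<close> the displacements \<open>x\<close> and
    \<open>x + v\<close> both lie in \<open>E n\<close>. Their difference costs
    \<open>2 + 2\<close>, and passing from \<open>L (u - x)\<close> to \<open>L u\<close> doubles
    this to 8.\<close>
  have step: "eventually (\<lambda>u. \<forall>v\<in>{0..e}. \<bar>F (u + v) - F u\<bar> \<le> 8 * L u) at_top"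
    using eventually_at_top_shift[OF eventually_ge_at_top[of "u1 + real n"], of "-x"] dbl[of "-x"]
  proof eventually_elim
    fix u assume u: "u1 + real n \<le> u + - x" "L (u + - x) \<le> 2 * L u"
    show "\<forall>v\<in>{0..e}. \<bar>F (u + v) - F u\<bar> \<le> 8 * L u"
    proof
      fix v assume v: "v \<in> {0..e}"
      have "x \<in> E n" "x + v \<in> E n" using e v by (auto simp: subset_iff dist_norm)
      then have "\<bar>F ((u + - x) + x) - F (u + - x)\<bar> \<le> 2 * L (u + - x)"
        "\<bar>F ((u + - x) + (x + v)) - F (u + - x)\<bar> \<le> 2 * L (u + - x)"
        using u(1) unfolding E_def by blast+
      then show "\<bar>F (u + v) - F u\<bar> \<le> 8 * L u" using u(2) by (simp add: add.assoc[symmetric])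
    qed
  qed
  \<comment> \<open>Finitely many steps of length \<open>e\<close> exhaust the unit interval. Each
    turns \<open>C\<close> into \<open>8 + 2 * C\<close>, the 2 paying for the passage from
    \<open>L (u + e)\<close> to \<open>L u\<close>.\<close>
  have iter: "\<exists>C>0. eventually (\<lambda>u. \<forall>v\<in>{0..real (Suc k) * e}. \<bar>F (u + v) - F u\<bar> \<le> C * L u) at_top" for k
  proof (induction k)
    case 0
    then show ?case using step by (intro exI[of _ 8]) simp
  next
    case (Suc k)
    then obtain C where C: "C > 0"
      "eventually (\<lambda>u. \<forall>v\<in>{0..real (Suc k) * e}. \<bar>F (u + v) - F u\<bar> \<le> C * L u) at_top" by blast
    have "eventually (\<lambda>u. \<forall>v\<in>{0..real (Suc (Suc k)) * e}. \<bar>F (u + v) - F u\<bar> \<le> (8 + 2 * C) * L u) at_top"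
      using eventually_at_top_shift[OF C(2), of e] dbl[of e] step pos
    proof eventually_elim
      fix u assume *: "\<forall>v\<in>{0..real (Suc k) * e}. \<bar>F (u + e + v) - F (u + e)\<bar> \<le> C * L (u + e)"
        "L (u + e) \<le> 2 * L u" "\<forall>v\<in>{0..e}. \<bar>F (u + v) - F u\<bar> \<le> 8 * L u" "0 < L u"
      have CL: "C * L (u + e) \<le> C * (2 * L u)" using *(2) C(1) by (intro mult_left_mono) auto
      show "\<forall>v\<in>{0..real (Suc (Suc k)) * e}. \<bar>F (u + v) - F u\<bar> \<le> (8 + 2 * C) * L u"
      proof
        fix v assume v: "v \<in> {0..real (Suc (Suc k)) * e}"
        show "\<bar>F (u + v) - F u\<bar> \<le> (8 + 2 * C) * L u"
        proof (cases "v \<le> e")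
          case True
          then have "\<bar>F (u + v) - F u\<bar> \<le> 8 * L u" using v *(3) by auto
          moreover have "0 \<le> C * L u" using C(1) *(4) by simp
          ultimately show ?thesis by (simp add: algebra_simps)
        next
          case False
          then have "v - e \<in> {0..real (Suc k) * e}" using v by (auto simp: algebra_simps)
          then have "\<bar>F (u + e + (v - e)) - F (u + e)\<bar> \<le> C * L (u + e)" using *(1) by blast
          moreover have "\<bar>F (u + e) - F u\<bar> \<le> 8 * L u" using *(3) e(1) by auto
          ultimately show ?thesis using CL by (simp add: algebra_simps)
        qed
      qed
    qed
    then show ?case using C(1) by (intro exI[of _ "8 + 2 * C"]) auto
  qed
  obtain k where "1 / e \<le> real k" using real_arch_simple by blast
  then have k: "1 \<le> real (Suc k) * e" using e(1) by (simp add: field_simps)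
  from iter[of k] obtain C where "C > 0"
    "eventually (\<lambda>u. \<forall>v\<in>{0..real (Suc k) * e}. \<bar>F (u + v) - F u\<bar> \<le> C * L u) at_top" by blast
  with k show ?thesis by (intro exI[of _ C]) (auto elim!: eventually_mono)
qed

text \<open>\<open>L\<close> is comparable to the unit increment \<open>F (u + 1) - F u\<close>, so
  the local bound for \<open>F\<close> carries over to \<open>L\<close> itself.\<close>

lemma slowly_varying_local_bound:
  fixes F L :: "real \<Rightarrow> real"
  assumes cont: "continuous_on UNIV F"
    and pos: "eventually (\<lambda>u. 0 < L u) at_top"
    and sv: "\<And>v. ((\<lambda>u. L (u + v) / L u) \<longlongrightarrow> 1) at_top"
    and dh: "\<And>v. ((\<lambda>u. (F (u + v) - F u) / L u) \<longlongrightarrow> v) at_top"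
  shows "\<exists>K>0. eventually (\<lambda>u. \<forall>v\<in>{0..1}. L (u + v) \<le> K * L u \<and> L u \<le> K * L (u + v)) at_top"
proof -
  obtain C where C: "C > 0" "eventually (\<lambda>u. \<forall>v\<in>{0..1}. \<bar>F (u + v) - F u\<bar> \<le> C * L u) at_top"
    using deHaan_local_bound[OF assms] by blast
  have two: "1 < (2::real)" "1/2 < (1::real)" by simp_all
  have half: "eventually (\<lambda>u. L u \<le> 2 * (F (u + 1) - F u)) at_top"
    using order_tendstoD(1)[OF dh[of 1] two(2)] pos
    by eventually_elim (auto simp: field_simps)
  have "eventually (\<lambda>u. L (u + 1) < 2 * L u \<and> L u < 2 * L (u + 1)) at_top"
    using order_tendstoD(2)[OF sv[of 1] two(1)] order_tendstoD(1)[OF sv[of 1] two(2)] pos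
    by eventually_elim (auto simp: field_simps)
  with half C(2) pos have "eventually (\<lambda>u. L u \<le> 2 * (F (u + 1) - F u) \<and> L (u + 1) < 2 * L u \<and> L u < 2 * L (u + 1)
      \<and> 0 < L u \<and> (\<forall>v\<in>{0..1}. \<bar>F (u + v) - F u\<bar> \<le> C * L u)) at_top"
    by eventually_elim blast
  then obtain u0 where half: "\<And>u. u \<ge> u0 \<Longrightarrow> L u \<le> 2 * (F (u + 1) - F u)"
    and one: "\<And>u. u \<ge> u0 \<Longrightarrow> L (u + 1) < 2 * L u" "\<And>u. u \<ge> u0 \<Longrightarrow> L u < 2 * L (u + 1)"
    and loc: "\<And>u v. u \<ge> u0 \<Longrightarrow> v \<in> {0..1} \<Longrightarrow> \<bar>F (u + v) - F u\<bar> \<le> C * L u"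
    and posu: "\<And>u. u \<ge> u0 \<Longrightarrow> 0 < L u"
    unfolding eventually_at_top_linorder by blast
  \<comment> \<open>\<open>F (u + v + 1) - F (u + v)\<close> telescopes through \<open>u + 1\<close>
    and \<open>u\<close>. The three increments cost \<open>2 * C\<close>, \<open>C\<close> and
    \<open>C\<close> times \<open>L u\<close>, and the factor 2 of \<open>half\<close> makes this
    8.\<close>
  have up: "L (u + v) \<le> 8 * C * L u" if "u \<ge> u0" "v \<in> {0..1}" for u v
  proof -
    have "L (u + v) \<le> 2 * (F (u + v + 1) - F (u + v))" using half[of "u + v"] that by auto
    moreover have "\<bar>F (u + 1 + v) - F (u + 1)\<bar> \<le> C * L (u + 1)" using loc[of "u + 1" v] that by auto
    moreover have "C * L (u + 1) \<le> C * (2 * L u)" using one(1)[of u] that C(1) by (intro mult_left_mono) auto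
    moreover have "\<bar>F (u + v) - F u\<bar> \<le> C * L u" "\<bar>F (u + 1) - F u\<bar> \<le> C * L u" using loc that by auto
    ultimately show ?thesis by (simp add: algebra_simps)
  qed
  \<comment> \<open>Moving on from \<open>u + v\<close> by \<open>1 - v\<close> ends at
    \<open>u + 1\<close>, where \<open>one\<close> compares \<open>L\<close> with
    \<open>L u\<close>.\<close>
  have "L u \<le> 16 * C * L (u + v)" if "u \<ge> u0" "v \<in> {0..1}" for u v
    using up[of "u + v" "1 - v"] one(2)[of u] that by auto
  moreover have "L (u + v) \<le> 16 * C * L u" if "u \<ge> u0" "v \<in> {0..1}" for u v
  proof -
    have "0 \<le> C * L u" using C(1) posu[OF that(1)] by simp
    then show ?thesis using up[OF that] by linarith
  qed
  ultimately show ?thesis using C(1)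
    by (intro exI[of _ "16 * C"] conjI eventually_mono[OF eventually_ge_at_top[of u0]]) auto
qed

text \<open>Far out, a unit step costs at most a factor \<open>exp \<delta>\<close>, and
  \<open>K\<close> pays once for the fractional part of \<open>v\<close>. In the variable
  \<open>exp u\<close> this is Potter's bound with power \<open>\<delta>\<close>.\<close>

lemma potter_bounds:
  fixes F L :: "real \<Rightarrow> real"
  assumes cont: "continuous_on UNIV F"
    and pos: "eventually (\<lambda>u. 0 < L u) at_top"
    and sv: "\<And>v. ((\<lambda>u. L (u + v) / L u) \<longlongrightarrow> 1) at_top"
    and dh: "\<And>v. ((\<lambda>u. (F (u + v) - F u) / L u) \<longlongrightarrow> v) at_top"
    and \<delta>: "\<delta> > 0"
  shows "\<exists>K>0. eventually (\<lambda>u. \<forall>v\<ge>0. L (u + v) \<le> K * exp (\<delta> * v) * L u \<and> L u \<le> K * exp (\<delta> * v) * L (u + v)) at_top"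
proof -
  obtain K where K: "K > 0"
    "eventually (\<lambda>u. \<forall>v\<in>{0..1}. L (u + v) \<le> K * L u \<and> L u \<le> K * L (u + v)) at_top"
    using slowly_varying_local_bound[OF cont pos sv dh] by blast
  have ex: "exp (- \<delta>) < 1" "1 < exp \<delta>" using \<delta> by auto
  have "eventually (\<lambda>u. L (u + 1) \<le> exp \<delta> * L u \<and> L u \<le> exp \<delta> * L (u + 1)) at_top"
    using order_tendstoD(2)[OF sv[of 1] ex(2)] order_tendstoD(1)[OF sv[of 1] ex(1)] pos
  proof eventually_elim
    case (elim u)
    then show ?case by (auto simp: exp_minus field_simps)
  qed
  with K(2) pos have "eventually (\<lambda>u. 0 < L u \<and> (L (u + 1) \<le> exp \<delta> * L u \<and> L u \<le> exp \<delta> * L (u + 1)) \<and>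
     (\<forall>v\<in>{0..1}. L (u + v) \<le> K * L u \<and> L u \<le> K * L (u + v))) at_top"
    by eventually_elim blast
  then obtain u0 where u0: "\<And>u. u \<ge> u0 \<Longrightarrow> 0 < L u"
    "\<And>u. u \<ge> u0 \<Longrightarrow> L (u + 1) \<le> exp \<delta> * L u" "\<And>u. u \<ge> u0 \<Longrightarrow> L u \<le> exp \<delta> * L (u + 1)"
    and loc: "\<And>u v. u \<ge> u0 \<Longrightarrow> v \<in> {0..1} \<Longrightarrow> L (u + v) \<le> K * L u"
    "\<And>u v. u \<ge> u0 \<Longrightarrow> v \<in> {0..1} \<Longrightarrow> L u \<le> K * L (u + v)"
    unfolding eventually_at_top_linorder by blast
  have steps: "L (u + real n) \<le> exp (\<delta> * real n) * L u \<and> L u \<le> exp (\<delta> * real n) * L (u + real n)"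
    if u: "u \<ge> u0" for u n
  proof (induction n)
    case (Suc n)
    have e: "exp (\<delta> * real (Suc n)) = exp \<delta> * exp (\<delta> * real n)" by (simp add: exp_add[symmetric] algebra_simps)
    have s: "u + real (Suc n) = u + real n + 1" by simp
    have "L (u + real (Suc n)) \<le> exp \<delta> * L (u + real n)" unfolding s using u by (intro u0(2)) auto
    also have "\<dots> \<le> exp \<delta> * (exp (\<delta> * real n) * L u)" using Suc by (intro mult_left_mono) auto
    finally have 1: "L (u + real (Suc n)) \<le> exp (\<delta> * real (Suc n)) * L u" by (simp only: e mult.assoc)
    have "L u \<le> exp (\<delta> * real n) * L (u + real n)" using Suc by blast
    also have "\<dots> \<le> exp (\<delta> * real n) * (exp \<delta> * L (u + real (Suc n)))" unfolding s
      using u by (intro mult_left_mono u0(3)) auto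
    finally have "L u \<le> exp (\<delta> * real (Suc n)) * L (u + real (Suc n))" by (simp only: e mult_ac)
    with 1 show ?case by blast
  qed simp
  have "L (u + v) \<le> K * exp (\<delta> * v) * L u \<and> L u \<le> K * exp (\<delta> * v) * L (u + v)" if u: "u \<ge> u0" and v: "v \<ge> 0" for u v
  proof -
    define n where "n = nat \<lfloor>v\<rfloor>"
    have n: "real n \<le> v" "v - real n \<in> {0..1}" using v by (auto simp: n_def) linarith+
    have uv: "u + v = (u + real n) + (v - real n)" by simp
    have ex: "exp (\<delta> * real n) \<le> exp (\<delta> * v)" using n \<delta> by simp
    have Luv: "0 < L (u + v)" "0 < L u" using u0(1) u v by auto
    have "L (u + v) \<le> K * L (u + real n)" by (subst uv) (intro loc(1) n(2), use u in auto)
    also have "\<dots> \<le> K * (exp (\<delta> * real n) * L u)" using K steps[OF u] by (intro mult_left_mono) auto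
    also have "\<dots> \<le> K * (exp (\<delta> * v) * L u)" using K Luv ex by (intro mult_left_mono mult_right_mono) auto
    finally have 1: "L (u + v) \<le> K * exp (\<delta> * v) * L u" by (simp add: mult.assoc)
    have "L u \<le> exp (\<delta> * real n) * L (u + real n)" using steps[OF u] by blast
    also have "L (u + real n) \<le> K * L (u + v)" by (subst uv) (intro loc(2) n(2), use u in auto)
    also have "exp (\<delta> * real n) * (K * L (u + v)) \<le> exp (\<delta> * v) * (K * L (u + v))"
      using K Luv ex by (intro mult_right_mono) auto
    finally show ?thesis using 1 by (simp add: mult_ac)
  qed
  then show ?thesis using K(1)
    by (intro exI[of _ K] conjI eventually_mono[OF eventually_ge_at_top[of u0]]) auto
qed

text \<open>Boundedness of \<open>L\<close> makes the increments over unit steps bounded. In the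
  original variable the growth is logarithmic, and a small factor \<open>t\<close> then turns it
  into a small power after exponentiation.\<close>

lemma deHaan_linear_growth:
  fixes F L :: "real \<Rightarrow> real"
  assumes cont: "continuous_on UNIV F"
    and pos: "eventually (\<lambda>u. 0 < L u) at_top"
    and sv: "\<And>v. ((\<lambda>u. L (u + v) / L u) \<longlongrightarrow> 1) at_top"
    and dh: "\<And>v. ((\<lambda>u. (F (u + v) - F u) / L u) \<longlongrightarrow> v) at_top"
    and bdd: "eventually (\<lambda>u. L u \<le> B) at_top"
  shows "\<exists>K>0. eventually (\<lambda>u. \<forall>v\<ge>0. \<bar>F (u + v) - F u\<bar> \<le> K * (1 + v)) at_top"
proof -
  obtain C where C: "C > 0" "eventually (\<lambda>u. \<forall>v\<in>{0..1}. \<bar>F (u + v) - F u\<bar> \<le> C * L u) at_top"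
    using deHaan_local_bound[OF cont pos sv dh] by blast
  from C(2) bdd pos have "eventually (\<lambda>u. 0 < L u \<and> L u \<le> B \<and> (\<forall>v\<in>{0..1}. \<bar>F (u + v) - F u\<bar> \<le> C * L u)) at_top"
    by eventually_elim blast
  then obtain u0 where u0: "\<And>u. u \<ge> u0 \<Longrightarrow> 0 < L u" "\<And>u. u \<ge> u0 \<Longrightarrow> L u \<le> B"
    and loc: "\<And>u v. u \<ge> u0 \<Longrightarrow> v \<in> {0..1} \<Longrightarrow> \<bar>F (u + v) - F u\<bar> \<le> C * L u"
    unfolding eventually_at_top_linorder by blast
  define K where "K = C * B"
  have "B > 0" using u0(1,2)[of u0] by linarith
  then have K: "K > 0" using C by (simp add: K_def)
  have loc': "\<bar>F (u + v) - F u\<bar> \<le> K" if "u \<ge> u0" "v \<in> {0..1}" for u v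
  proof -
    have "C * L u \<le> C * B" using C u0(2) that by (intro mult_left_mono) auto
    with loc[OF that] show ?thesis by (simp add: K_def)
  qed
  have steps: "\<bar>F (u + real n) - F u\<bar> \<le> K * real n" if "u \<ge> u0" for u n
  proof (induction n)
    case (Suc n)
    have "\<bar>F (u + real n + 1) - F (u + real n)\<bar> \<le> K" using that by (intro loc') auto
    then have "\<bar>F (u + real (Suc n)) - F (u + real n)\<bar> \<le> K" by (simp add: add.commute add.left_commute)
    with Suc show ?case by (simp add: algebra_simps)
  qed simp
  have "\<bar>F (u + v) - F u\<bar> \<le> K * (1 + v)" if u: "u \<ge> u0" and v: "v \<ge> 0" for u v
  proof -
    define n where "n = nat \<lfloor>v\<rfloor>"
    have n: "real n \<le> v" "v - real n \<in> {0..1}" using v by (auto simp: n_def) linarith+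
    have "\<bar>F ((u + real n) + (v - real n)) - F (u + real n)\<bar> \<le> K" by (intro loc' n(2)) (use u in auto)
    then have "\<bar>F (u + v) - F u\<bar> \<le> K + K * real n" using steps[OF u, of n] by simp
    also have "\<dots> \<le> K * (1 + v)" using n(1) K by (simp add: algebra_simps)
    finally show ?thesis .
  qed
  then show ?thesis using K
    by (intro exI[of _ K] conjI eventually_mono[OF eventually_ge_at_top[of u0]]) auto
qed

text \<open>The preceding estimates at \<open>u = ln x\<close>. The two bounds in \<open>R\<close>
  and \<open>z\<close> serve arguments \<open>R * z\<close> beyond \<open>x1\<close>; the last two
  serve smaller \<open>R * z\<close>, where only the size of \<open>R\<close> can be exploited. The
  power 1/4 is half of the power 1/2 allowed by the integrable majorant.\<close>

lemma deHaan_bounds: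
  fixes f l :: "real \<Rightarrow> real"
  assumes cont: "continuous_on UNIV f"
    and sv: "slowly_varying_inf l"
    and bdd: "\<exists>B a. \<forall>x\<ge>a. \<bar>l x\<bar> \<le> B"
    and dh: "deHaan_inf l f"
  obtains K x1 where "K \<ge> 1" "x1 \<ge> 1" "\<And>x. x \<ge> x1 \<Longrightarrow> 0 < l x"
    "\<And>R z. \<lbrakk>R \<ge> x1; z > 0; R * z \<ge> x1\<rbrakk> \<Longrightarrow> \<bar>f (2 * (R * z)) - f (R * z)\<bar> \<le> K * exp (\<bar>ln z\<bar> / 4) * l R"
    "\<And>R z. \<lbrakk>R \<ge> x1; z > 0; R * z \<ge> x1\<rbrakk> \<Longrightarrow> \<bar>f (R * z) - f R\<bar> \<le> K * (1 + \<bar>ln z\<bar>)"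
    "\<And>R. R \<ge> x1 \<Longrightarrow> 1 \<le> K * exp (ln R / 4) * l R"
    "\<And>R. R \<ge> x1 \<Longrightarrow> f R \<le> K * (1 + ln R)"
proof -
  define F where "F u = f (exp u)" for u
  define L where "L u = l (exp u)" for u
  have contF: "continuous_on UNIV F" unfolding F_def
    by (intro continuous_on_compose2[OF cont] continuous_intros) auto
  have ev: "eventually (\<lambda>u. P (exp u)) at_top" if "eventually P at_top" for P :: "real \<Rightarrow> bool"
    using that exp_at_top by (rule eventually_compose_filterlim)
  have pos: "eventually (\<lambda>u. 0 < L u) at_top"
    unfolding L_def using sv by (intro ev) (auto simp: slowly_varying_inf_def eventually_at_top_linorder)
  obtain B where B: "eventually (\<lambda>u. L u \<le> B) at_top"
  proof -
    obtain B a where "\<And>x. x \<ge> a \<Longrightarrow> \<bar>l x\<bar> \<le> B" using bdd by blast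
    then have "eventually (\<lambda>x. l x \<le> B) at_top"
      unfolding eventually_at_top_linorder by (meson abs_le_D1)
    then show ?thesis using that ev unfolding L_def by blast
  qed
  have svL: "((\<lambda>u. L (u + v) / L u) \<longlongrightarrow> 1) at_top" for v
  proof -
    have "((\<lambda>x. l (exp v * x) / l x) \<longlongrightarrow> 1) at_top" using sv by (simp add: slowly_varying_inf_def)
    from filterlim_compose[OF this exp_at_top] show ?thesis
      by (simp add: L_def exp_add mult.commute)
  qed
  have dhF: "((\<lambda>u. (F (u + v) - F u) / L u) \<longlongrightarrow> v) at_top" for v
  proof -
    have "((\<lambda>x. (f (exp v * x) - f x) / l x) \<longlongrightarrow> ln (exp v)) at_top"
      using dh unfolding deHaan_inf_def by (meson exp_gt_zero)
    from filterlim_compose[OF this exp_at_top] show ?thesis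
      by (simp add: L_def F_def exp_add mult.commute)
  qed
  note FL = contF pos svL dhF
  obtain C where C: "C > 0" "eventually (\<lambda>u. \<forall>v\<in>{0..1}. \<bar>F (u + v) - F u\<bar> \<le> C * L u) at_top"
    using deHaan_local_bound[OF FL] by blast
  obtain P where P: "P > 0" "eventually (\<lambda>u. \<forall>v\<ge>0. L (u + v) \<le> P * exp (1/4 * v) * L u \<and> L u \<le> P * exp (1/4 * v) * L (u + v)) at_top"
    using potter_bounds[OF FL, of "1/4"] by auto
  obtain G where G: "G > 0" "eventually (\<lambda>u. \<forall>v\<ge>0. \<bar>F (u + v) - F u\<bar> \<le> G * (1 + v)) at_top"
    using deHaan_linear_growth[OF FL B] by blast
  from pos C(2) P(2) G(2) eventually_ge_at_top[of 0]
  have "eventually (\<lambda>u. 0 \<le> u \<and> 0 < L u \<and> (\<forall>v\<in>{0..1}. \<bar>F (u + v) - F u\<bar> \<le> C * L u) \<and>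
     (\<forall>v\<ge>0. L (u + v) \<le> P * exp (1/4 * v) * L u \<and> L u \<le> P * exp (1/4 * v) * L (u + v)) \<and>
     (\<forall>v\<ge>0. \<bar>F (u + v) - F u\<bar> \<le> G * (1 + v))) at_top"
    by eventually_elim blast
  then obtain u0' where u0': "\<And>u. u \<ge> u0' \<Longrightarrow> 0 \<le> u \<and> 0 < L u \<and> (\<forall>v\<in>{0..1}. \<bar>F (u + v) - F u\<bar> \<le> C * L u) \<and>
     (\<forall>v\<ge>0. L (u + v) \<le> P * exp (1/4 * v) * L u \<and> L u \<le> P * exp (1/4 * v) * L (u + v)) \<and>
     (\<forall>v\<ge>0. \<bar>F (u + v) - F u\<bar> \<le> G * (1 + v))"
    unfolding eventually_at_top_linorder by blast
  define u0 where "u0 = max 0 u0'"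
  have u0: "u0 \<ge> 0" "\<And>u. u \<ge> u0 \<Longrightarrow> 0 < L u"
    "\<And>u v. \<lbrakk>u \<ge> u0; v \<in> {0..1}\<rbrakk> \<Longrightarrow> \<bar>F (u + v) - F u\<bar> \<le> C * L u"
    "\<And>u v. \<lbrakk>u \<ge> u0; v \<ge> 0\<rbrakk> \<Longrightarrow> L (u + v) \<le> P * exp (1/4 * v) * L u"
    "\<And>u v. \<lbrakk>u \<ge> u0; v \<ge> 0\<rbrakk> \<Longrightarrow> L u \<le> P * exp (1/4 * v) * L (u + v)"
    "\<And>u v. \<lbrakk>u \<ge> u0; v \<ge> 0\<rbrakk> \<Longrightarrow> \<bar>F (u + v) - F u\<bar> \<le> G * (1 + v)"
    using u0' by (simp_all add: u0_def)
  \<comment> \<open>For negative \<open>v\<close> the other Potter inequality is used, from the base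
    point \<open>u + v\<close> with displacement \<open>- v\<close>.\<close>
  have Lboth: "L (u + v) \<le> P * exp (\<bar>v\<bar> / 4) * L u" if "u \<ge> u0" "u + v \<ge> u0" for u v
    using u0(4)[of u v] u0(5)[of "u + v" "- v"] that by (cases "v \<ge> 0") auto
  have Fboth: "\<bar>F (u + v) - F u\<bar> \<le> G * (1 + \<bar>v\<bar>)" if "u \<ge> u0" "u + v \<ge> u0" for u v
    using u0(6)[of u v] u0(6)[of "u + v" "- v"] that by (cases "v \<ge> 0") (auto simp: abs_minus_commute)
  define K where "K = max 1 (max (C * P) (max G (max (P / L u0) (\<bar>F u0\<bar> + G))))"
  have K: "K \<ge> 1" "C * P \<le> K" "G \<le> K" "P / L u0 \<le> K" "\<bar>F u0\<bar> + G \<le> K" by (auto simp: K_def)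
  define x1 where "x1 = exp u0"
  have lnx: "ln x \<ge> u0" "x > 0" if "x \<ge> x1" for x
  proof -
    show "x > 0" using that less_le_trans[OF exp_gt_zero[of u0]] by (simp add: x1_def)
    then show "ln x \<ge> u0" using that by (simp add: x1_def ln_ge_iff)
  qed
  have lL: "l x = L (ln x)" "f x = F (ln x)" if "x > 0" for x using that by (simp_all add: L_def F_def)
  show ?thesis
  proof (rule that[of K x1])
    show "K \<ge> 1" by fact
    show "x1 \<ge> 1" using u0(1) by (simp add: x1_def)
    show "0 < l x" if "x \<ge> x1" for x using lnx[OF that] u0(2) by (simp add: lL)
    show "\<bar>f (2 * (R * z)) - f (R * z)\<bar> \<le> K * exp (\<bar>ln z\<bar> / 4) * l R" if "R \<ge> x1" "z > 0" "R * z \<ge> x1" for R z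
    proof -
      note R = lnx[OF that(1)] and Rz = lnx[OF that(3)]
      have lnRz: "ln (R * z) = ln R + ln z" using R that by (simp add: ln_mult)
      have ln2: "ln (2 * (R * z)) = ln (R * z) + ln 2" using Rz by (subst ln_mult) auto
      have "\<bar>F (ln (R * z) + ln 2) - F (ln (R * z))\<bar> \<le> C * L (ln (R * z))"
        using u0(3)[of "ln (R * z)" "ln 2"] Rz(1) ln_2_less_1 by auto
      also have "\<dots> \<le> C * (P * exp (\<bar>ln z\<bar> / 4) * L (ln R))"
        using Lboth[of "ln R" "ln z"] R(1) Rz(1) C(1) unfolding lnRz by (intro mult_left_mono) auto
      also have "\<dots> = (C * P) * (exp (\<bar>ln z\<bar> / 4) * L (ln R))" by simp
      also have "\<dots> \<le> K * (exp (\<bar>ln z\<bar> / 4) * L (ln R))"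
        using K(2) u0(2)[OF R(1)] by (intro mult_right_mono) auto
      finally show ?thesis using R Rz by (simp add: lL ln2 mult.assoc)
    qed
    show "\<bar>f (R * z) - f R\<bar> \<le> K * (1 + \<bar>ln z\<bar>)" if "R \<ge> x1" "z > 0" "R * z \<ge> x1" for R z
    proof -
      note R = lnx[OF that(1)] and Rz = lnx[OF that(3)]
      have lnRz: "ln (R * z) = ln R + ln z" using R that by (simp add: ln_mult)
      have "\<bar>F (ln (R * z)) - F (ln R)\<bar> \<le> G * (1 + \<bar>ln z\<bar>)"
        using Fboth[of "ln R" "ln z"] R(1) Rz(1) unfolding lnRz by simp
      also have "\<dots> \<le> K * (1 + \<bar>ln z\<bar>)" using K(3) by (intro mult_right_mono) auto
      finally show ?thesis using R Rz by (simp add: lL)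
    qed
    show "1 \<le> K * exp (ln R / 4) * l R" if "R \<ge> x1" for R
    proof -
      note R = lnx[OF that]
      have "L u0 \<le> P * exp (1/4 * (ln R - u0)) * L (ln R)" using u0(5)[of u0 "ln R - u0"] R by simp
      also have "\<dots> \<le> P * exp (ln R / 4) * L (ln R)"
        using P(1) u0(1) u0(2)[OF R(1)] by (intro mult_right_mono mult_left_mono) auto
      finally have "1 \<le> (P / L u0) * (exp (ln R / 4) * L (ln R))"
        using u0(2)[of u0] by (simp add: field_simps)
      also have "\<dots> \<le> K * (exp (ln R / 4) * L (ln R))"
        using K(4) u0(2)[OF R(1)] by (intro mult_right_mono) auto
      finally show ?thesis using R by (simp add: lL mult.assoc)
    qed
    show "f R \<le> K * (1 + ln R)" if "R \<ge> x1" for R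
    proof -
      note R = lnx[OF that]
      have "F (ln R) \<le> \<bar>F u0\<bar> + G * (1 + (ln R - u0))" using u0(6)[of u0 "ln R - u0"] R by simp
      also have "\<dots> \<le> \<bar>F u0\<bar> + G * (1 + ln R)" using G(1) u0(1) by (intro add_left_mono mult_left_mono) auto
      also have "\<dots> = (\<bar>F u0\<bar> + G) + G * ln R" by (simp add: algebra_simps)
      also have "\<dots> \<le> K + K * ln R" using K R(1) u0(1) by (intro add_mono mult_right_mono) auto
      finally show ?thesis using R by (simp add: lL algebra_simps)
    qed
  qed
qed

section \<open>Domination and joint limits of the normalised exponential differences\<close>

lemma exp_minus_diff_bound:
  fixes a b c :: real
  assumes "c \<le> a" "c \<le> b"
  shows "\<bar>exp (- a) - exp (- b)\<bar> \<le> \<bar>a - b\<bar> * exp (- c)"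
proof -
  have *: "exp (- x) - exp (- y) \<le> (y - x) * exp (- c)" if "x \<le> y" "c \<le> x" for x y
  proof -
    have "exp (- x) - exp (- y) = exp (- x) * (1 - exp (- (y - x)))" by (simp add: algebra_simps exp_diff exp_minus field_simps)
    also have "\<dots> \<le> exp (- x) * (y - x)"
    proof (intro mult_left_mono)
      show "1 - exp (- (y - x)) \<le> y - x" using exp_ge_add_one_self[of "- (y - x)"] by linarith
    qed simp
    also have "\<dots> \<le> exp (- c) * (y - x)" using that by (intro mult_right_mono) auto
    finally show ?thesis by (simp add: mult.commute)
  qed
  show ?thesis
  proof (cases "a \<le> b")
    case True
    then have "exp (- b) \<le> exp (- a)" by simp
    then show ?thesis using *[OF True assms(1)] True by simp
  next
    case False
    then have "exp (- a) \<le> exp (- b)" by simp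
    then show ?thesis using *[of b a] False assms by simp
  qed
qed

text \<open>The claimed order of \<open>p t x\<close> at \<open>R = 1 / norm x\<close>, without the
  factor \<open>R ^ DIM('a)\<close>.\<close>

definition decay_weight :: "(real \<Rightarrow> real) \<Rightarrow> (real \<Rightarrow> real) \<Rightarrow> real \<Rightarrow> real \<Rightarrow> real" where
  "decay_weight f l t R = t * l R * exp (- (t * f R))"

definition exponent_quotient :: "(real \<Rightarrow> real) \<Rightarrow> (real \<Rightarrow> real) \<Rightarrow> real \<Rightarrow> real \<Rightarrow> real \<Rightarrow> real" where
  "exponent_quotient f l t R z =
     (exp (- (t * f (R * z))) - exp (- (t * f (2 * (R * z))))) / decay_weight f l t R"

text \<open>While \<open>R * z \<ge> x1\<close>, the Potter bound and the growth bound contribute a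
  power 1/4 each. For smaller \<open>R * z\<close> the numerator is only known to be of order
  \<open>t\<close>, but then \<open>z < x1 / R\<close>, so the powers of \<open>R\<close> lost in
  comparing with \<open>decay_weight\<close> are paid by \<open>exp (|ln z| / 2)\<close>.\<close>

lemma exponent_quotient_bound:
  fixes f l :: "real \<Rightarrow> real"
  assumes cont: "continuous_on UNIV f" and nonneg: "\<And>x. 0 \<le> f x"
    and sv: "slowly_varying_inf l"
    and bdd: "\<exists>B a. \<forall>x\<ge>a. \<bar>l x\<bar> \<le> B"
    and dh: "deHaan_inf l f"
  obtains C t1 R1 where "t1 > 0"
    "\<And>t R z. \<lbrakk>0 < t; t \<le> t1; R \<ge> R1; z > 0\<rbrakk> \<Longrightarrow> \<bar>exponent_quotient f l t R z\<bar> \<le> C * exp (\<bar>ln z\<bar> / 2)"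
proof -
  obtain K x1 where K: "K \<ge> 1" and x1: "x1 \<ge> 1" and lpos: "\<And>x. x \<ge> x1 \<Longrightarrow> 0 < l x"
    and D: "\<And>R z. \<lbrakk>R \<ge> x1; z > 0; R * z \<ge> x1\<rbrakk> \<Longrightarrow> \<bar>f (2 * (R * z)) - f (R * z)\<bar> \<le> K * exp (\<bar>ln z\<bar> / 4) * l R"
    and E: "\<And>R z. \<lbrakk>R \<ge> x1; z > 0; R * z \<ge> x1\<rbrakk> \<Longrightarrow> \<bar>f (R * z) - f R\<bar> \<le> K * (1 + \<bar>ln z\<bar>)"
    and l1: "\<And>R. R \<ge> x1 \<Longrightarrow> 1 \<le> K * exp (ln R / 4) * l R"
    and f1: "\<And>R. R \<ge> x1 \<Longrightarrow> f R \<le> K * (1 + ln R)"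
    using deHaan_bounds[OF cont sv bdd dh] by blast
  \<comment> \<open>The interval reaches \<open>2 * x1\<close> because \<open>f\<close> is evaluated
    at \<open>2 * (R * z)\<close> as well.\<close>
  have "compact (f ` {0..2 * x1})"
    by (intro compact_continuous_image continuous_on_subset[OF cont]) auto
  then obtain S where S: "\<And>x. 0 \<le> x \<Longrightarrow> x \<le> 2 * x1 \<Longrightarrow> \<bar>f x\<bar> \<le> S"
    using compact_imp_bounded bounded_iff by (metis atLeastAtMost_iff imageI real_norm_def)
  have S0: "S \<ge> 0" using S[of 0] x1 by linarith
  define C where "C = max (K * exp (1/2)) (S * K * exp (1/4) * exp (ln x1 / 2))"
  show ?thesis
  \<comment> \<open>This bound on \<open>t\<close> gives \<open>t * K \<le> 1/4\<close>, so the
    logarithmic growth of \<open>f\<close> costs at most a power 1/4.\<close>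
  proof (rule that[of "1 / (4 * K)" x1 C])
    show "1 / (4 * K) > 0" using K by auto
    fix t R z :: real
    assume t: "0 < t" "t \<le> 1 / (4 * K)" and R: "R \<ge> x1" and z: "z > 0"
    have tK: "t * K \<le> 1 / 4" using t(2) K by (simp add: field_simps)
    have lR: "0 < l R" by (rule lpos[OF R])
    have R0: "R > 0" using R x1 by linarith
    define W where "W = t * l R * exp (- (t * f R))"
    have W: "W > 0" using t lR by (simp add: W_def)
    have num: "\<bar>exp (- (t * f (R * z))) - exp (- (t * f (2 * (R * z))))\<bar> \<le> C * exp (\<bar>ln z\<bar> / 2) * W"
    proof (cases "R * z \<ge> x1")
      case True
      have z2: "\<bar>f (R * (2 * z)) - f R\<bar> \<le> K * (1 + \<bar>ln (2 * z)\<bar>)"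
        using True z x1 R by (intro E) auto
      have "\<bar>ln (2 * z)\<bar> \<le> 1 + \<bar>ln z\<bar>"
      proof -
        have "0 < ln (2::real)" by simp
        moreover have "ln (2 * z) = ln 2 + ln z" using z by (simp add: ln_mult)
        ultimately show ?thesis using ln_2_less_1 by linarith
      qed
      then have "K * (1 + \<bar>ln (2 * z)\<bar>) \<le> K * (2 + \<bar>ln z\<bar>)" using K by (intro mult_left_mono) auto
      with z2 have b2: "f R - K * (2 + \<bar>ln z\<bar>) \<le> f (2 * (R * z))" by (simp add: mult.left_commute)
      have "K * (1 + \<bar>ln z\<bar>) \<le> K * (2 + \<bar>ln z\<bar>)" using K by (intro mult_left_mono) auto
      with E[OF R z True] have b1: "f R - K * (2 + \<bar>ln z\<bar>) \<le> f (R * z)" by linarith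
      \<comment> \<open>A common lower bound for both exponents \<open>t * f (R * z)\<close> and
        \<open>t * f (2 * (R * z))\<close>; the 2 in \<open>2 + |ln z|\<close> leaves room for
        \<open>ln 2\<close>.\<close>
      define c where "c = t * (f R - K * (2 + \<bar>ln z\<bar>))"
      have "t * K * (2 + \<bar>ln z\<bar>) \<le> 1/4 * (2 + \<bar>ln z\<bar>)" using tK by (intro mult_right_mono) auto
      then have c: "- c \<le> - (t * f R) + (1/2 + \<bar>ln z\<bar> / 4)" by (simp add: c_def algebra_simps)
      have "\<bar>exp (- (t * f (R * z))) - exp (- (t * f (2 * (R * z))))\<bar>
          \<le> \<bar>t * f (R * z) - t * f (2 * (R * z))\<bar> * exp (- c)"
        unfolding c_def using t b1 b2 by (intro exp_minus_diff_bound mult_left_mono) auto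
      also have "\<bar>t * f (R * z) - t * f (2 * (R * z))\<bar> = t * \<bar>f (2 * (R * z)) - f (R * z)\<bar>"
        using t by (simp add: right_diff_distrib[symmetric] abs_mult abs_minus_commute)
      also have "\<dots> \<le> t * (K * exp (\<bar>ln z\<bar> / 4) * l R)"
        using t D[OF R z True] by (intro mult_left_mono) auto
      also have "t * (K * exp (\<bar>ln z\<bar> / 4) * l R) * exp (- c) \<le>
          t * (K * exp (\<bar>ln z\<bar> / 4) * l R) * exp (- (t * f R) + (1/2 + \<bar>ln z\<bar> / 4))"
        using t K lR c by (intro mult_left_mono) auto
      also have "\<dots> = (K * exp (1/2)) * exp (\<bar>ln z\<bar> / 4 + \<bar>ln z\<bar> / 4) * W"
        unfolding W_def exp_add by (simp add: mult_ac)
      also have "\<dots> = (K * exp (1/2)) * (exp (\<bar>ln z\<bar> / 2) * W)" by simp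
      also have "\<dots> \<le> C * (exp (\<bar>ln z\<bar> / 2) * W)" using W by (intro mult_right_mono) (auto simp: C_def)
      finally show ?thesis by simp
    next
      case False
      have "\<bar>exp (- (t * f (R * z))) - exp (- (t * f (2 * (R * z))))\<bar>
          \<le> \<bar>t * f (R * z) - t * f (2 * (R * z))\<bar> * exp (- 0)"
        using t nonneg by (intro exp_minus_diff_bound) auto
      also have "\<dots> = t * \<bar>f (R * z) - f (2 * (R * z))\<bar>"
        using t by (simp add: right_diff_distrib[symmetric] abs_mult)
      also have "\<dots> \<le> t * S"
        using t S[of "R * z"] S[of "2 * (R * z)"] nonneg[of "R * z"] nonneg[of "2 * (R * z)"] False R0 z x1
        by (intro mult_left_mono) auto
      \<comment> \<open>The inserted factor is at least 1 by \<open>l1\<close> and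
        \<open>f1\<close>; it supplies \<open>l R\<close> and \<open>exp (- (t * f R))\<close>, the
        missing ingredients of \<open>W\<close>.\<close>
      also have "\<dots> \<le> t * S * (K * exp (ln R / 4) * l R * exp (t * K * (1 + ln R) - t * f R))"
      proof -
        have "t * f R \<le> t * K * (1 + ln R)" using t f1[OF R] by (simp add: mult.assoc)
        then have "1 \<le> exp (t * K * (1 + ln R) - t * f R)" by simp
        from mult_mono[OF l1[OF R] this] have "1 \<le> K * exp (ln R / 4) * l R * exp (t * K * (1 + ln R) - t * f R)"
          using K lR by simp
        from mult_left_mono[OF this, of "t * S"] show ?thesis using t S0 by simp
      qed
      also have "\<dots> \<le> t * S * (K * exp (ln R / 4) * l R * exp (1/4 + ln R / 4 - t * f R))"
      proof -
        have "t * K * (1 + ln R) \<le> 1/4 * (1 + ln R)" using tK R x1 by (intro mult_right_mono) auto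
        then have "exp (t * K * (1 + ln R) - t * f R) \<le> exp (1/4 + ln R / 4 - t * f R)" by simp
        then show ?thesis using t S0 K lR by (intro mult_left_mono) auto
      qed
      also have "\<dots> = S * K * exp (1/4) * exp (ln R / 4 + ln R / 4) * W"
        unfolding W_def exp_add exp_diff exp_minus by (simp add: field_simps)
      also have "\<dots> \<le> S * K * exp (1/4) * exp (ln x1 / 2 + \<bar>ln z\<bar> / 2) * W"
      proof -
        \<comment> \<open>From \<open>R * z < x1\<close>, \<open>ln R\<close> is at most
          \<open>ln x1 + |ln z|\<close>: the power of \<open>R\<close> becomes a power of
          \<open>z\<close>.\<close>
        have "ln R + ln z = ln (R * z)" using R0 z by (simp add: ln_mult)
        also have "\<dots> \<le> ln x1" using False R0 z x1 by simp
        finally have "exp (ln R / 4 + ln R / 4) \<le> exp (ln x1 / 2 + \<bar>ln z\<bar> / 2)" by simp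
        then show ?thesis using S0 K W by (intro mult_right_mono mult_left_mono) auto
      qed
      also have "\<dots> = (S * K * exp (1/4) * exp (ln x1 / 2)) * (exp (\<bar>ln z\<bar> / 2) * W)"
        by (simp add: exp_add)
      also have "\<dots> \<le> C * (exp (\<bar>ln z\<bar> / 2) * W)" using W by (intro mult_right_mono) (auto simp: C_def)
      finally show ?thesis by simp
    qed
    then show "\<bar>exponent_quotient f l t R z\<bar> \<le> C * exp (\<bar>ln z\<bar> / 2)"
      using W unfolding exponent_quotient_def decay_weight_def W_def[symmetric] by (simp add: abs_divide pos_divide_le_eq)
  qed
qed

text \<open>The derivative of \<open>exp\<close> at 0. Filling in the singularity allows composition
  with any argument tending to 0.\<close>

lemma isCont_exp_difference_quotient: "isCont (\<lambda>x::real. if x = 0 then 1 else (1 - exp (- x)) / x) 0"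
proof -
  have "((\<lambda>x::real. (exp x - 1) / x) \<longlongrightarrow> 1) (at 0)"
    using DERIV_exp[of "0::real"] by (simp add: DERIV_def)
  then have "((\<lambda>x::real. (exp (- x) - 1) / (- x)) \<longlongrightarrow> 1) (at 0)"
    by (rule filterlim_compose) (auto intro!: tendsto_eq_intros simp: filterlim_at eventually_at_filter)
  then have "((\<lambda>x::real. (1 - exp (- x)) / x) \<longlongrightarrow> 1) (at 0)"
    by (simp add: minus_divide_left[symmetric] minus_divide_right[symmetric] diff_divide_distrib)
  then have "((\<lambda>x::real. if x = 0 then 1 else (1 - exp (- x)) / x) \<longlongrightarrow> 1) (at 0)"
    by (rule Lim_transform_eventually) (simp add: eventually_at_filter)
  then show ?thesis
    by (simp add: isCont_def)
qed

lemma bounded_product_tendsto_0: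
  fixes l :: "real \<Rightarrow> real" and t R :: "'c \<Rightarrow> real"
  assumes bdd: "\<exists>B a. \<forall>x\<ge>a. \<bar>l x\<bar> \<le> B"
    and t: "(t \<longlongrightarrow> 0) F" and R: "filterlim R at_top F"
  shows "((\<lambda>n. t n * l (R n)) \<longlongrightarrow> 0) F"
proof -
  obtain B a where B: "\<And>x. x \<ge> a \<Longrightarrow> \<bar>l x\<bar> \<le> B" using bdd by blast
  show ?thesis
  proof (rule Lim_null_comparison)
    show "eventually (\<lambda>n. norm (t n * l (R n)) \<le> \<bar>t n\<bar> * B) F"
      using R unfolding filterlim_at_top
      by (auto elim!: eventually_mono allE[of _ a] intro!: mult_left_mono B simp: abs_mult)
    show "((\<lambda>n. \<bar>t n\<bar> * B) \<longlongrightarrow> 0) F" using t by (auto intro!: tendsto_eq_intros)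
  qed
qed

lemma slowly_varying_inf_eventually_pos:
  assumes "slowly_varying_inf l" "filterlim R at_top F"
  shows "eventually (\<lambda>n. 0 < l (R n)) F"
proof -
  have "eventually (\<lambda>x. 0 < l x) at_top"
    using assms(1) by (auto simp: slowly_varying_inf_def eventually_at_top_linorder)
  then show ?thesis using assms(2) by (rule eventually_compose_filterlim)
qed

lemma deHaan_inf_tendsto_along:
  assumes "deHaan_inf l f" "filterlim R at_top F" "c > 0"
  shows "((\<lambda>n. (f (R n * c) - f (R n)) / l (R n)) \<longlongrightarrow> ln c) F"
proof -
  have "((\<lambda>x. (f (c * x) - f x) / l x) \<longlongrightarrow> ln c) at_top"
    using assms(1,3) by (simp add: deHaan_inf_def)
  from filterlim_compose[OF this assms(2)] show ?thesis by (simp add: mult.commute)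
qed

text \<open>The increment is of order \<open>l R\<close>, and \<open>t * l R\<close> tends to 0.
  This is why \<open>exp (- (t * f R))\<close> can be compared across scales even when
  \<open>t * f R\<close> does not converge.\<close>

lemma deHaan_small_increment_tendsto_0:
  fixes f l :: "real \<Rightarrow> real" and t R :: "'c \<Rightarrow> real"
  assumes sv: "slowly_varying_inf l"
    and bdd: "\<exists>B a. \<forall>x\<ge>a. \<bar>l x\<bar> \<le> B"
    and dh: "deHaan_inf l f"
    and t: "(t \<longlongrightarrow> 0) F" and R: "filterlim R at_top F"
    and c: "c > 0"
  shows "((\<lambda>n. t n * (f (R n * c) - f (R n))) \<longlongrightarrow> 0) F"
  by (rule Lim_transform_eventually[OF tendsto_mult[OF bounded_product_tendsto_0[OF bdd t R]
          deHaan_inf_tendsto_along[OF dh R c], unfolded mult_zero_left]])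
    (use slowly_varying_inf_eventually_pos[OF sv R] in \<open>auto elim!: eventually_mono\<close>)

text \<open>With \<open>D\<close> the increment of \<open>f\<close> from \<open>R * z\<close> to
  \<open>2 * (R * z)\<close>, the quotient is the product of
  \<open>exp (- (t * (f (R * z) - f R)))\<close>, \<open>D / l R\<close>, and
  \<open>(1 - exp (- x)) / x\<close> at \<open>x = t * D\<close>. The outer factors tend to 1, the
  middle one to \<open>ln (2 * z) - ln z\<close>, which is free of \<open>z\<close>.\<close>

lemma exponent_quotient_tendsto:
  fixes f l :: "real \<Rightarrow> real" and t R :: "'c \<Rightarrow> real"
  assumes sv: "slowly_varying_inf l"
    and bdd: "\<exists>B a. \<forall>x\<ge>a. \<bar>l x\<bar> \<le> B"
    and dh: "deHaan_inf l f"
    and t: "(t \<longlongrightarrow> 0) F" "eventually (\<lambda>n. 0 < t n) F" and R: "filterlim R at_top F"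
    and z: "z > 0"
  shows "((\<lambda>n. exponent_quotient f l (t n) (R n) z) \<longlongrightarrow> ln 2) F"
proof -
  note tl = bounded_product_tendsto_0[OF bdd t(1) R]
    and lpos = slowly_varying_inf_eventually_pos[OF sv R]
    and d = deHaan_inf_tendsto_along[OF dh R]
    and tE = deHaan_small_increment_tendsto_0[OF sv bdd dh t(1) R z]
  define D where "D n = f (2 * (R n * z)) - f (R n * z)" for n
  have "((\<lambda>n. (f (R n * (2 * z)) - f (R n)) / l (R n) - (f (R n * z) - f (R n)) / l (R n)) \<longlongrightarrow> ln (2 * z) - ln z) F"
    using z by (intro tendsto_diff d) auto
  then have Dl: "((\<lambda>n. D n / l (R n)) \<longlongrightarrow> ln 2) F"
    using z by (simp add: D_def ln_mult diff_divide_distrib mult.left_commute)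
  have tD: "((\<lambda>n. t n * D n) \<longlongrightarrow> 0) F"
    by (rule Lim_transform_eventually[OF tendsto_mult[OF tl Dl, unfolded mult_zero_left]])
      (use lpos in \<open>auto elim!: eventually_mono\<close>)
  define k where "k = (\<lambda>x::real. if x = 0 then 1 else (1 - exp (- x)) / x)"
  have k: "((\<lambda>n. k (t n * D n)) \<longlongrightarrow> 1) F"
    using isCont_tendsto_compose[OF isCont_exp_difference_quotient tD] by (simp add: k_def)
  have "((\<lambda>n. exp (- (t n * (f (R n * z) - f (R n)))) * (D n / l (R n)) * k (t n * D n)) \<longlongrightarrow> exp (- 0) * ln 2 * 1) F"
    by (intro tendsto_intros tE Dl k)
  then have "((\<lambda>n. exp (- (t n * (f (R n * z) - f (R n)))) * (D n / l (R n)) * k (t n * D n)) \<longlongrightarrow> ln 2) F"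
    by simp
  then show ?thesis
  proof (rule Lim_transform_eventually)
    have "eventually (\<lambda>n. 0 < D n / l (R n)) F" by (rule order_tendstoD(1)[OF Dl]) simp
    with lpos t(2) show "eventually (\<lambda>n. exp (- (t n * (f (R n * z) - f (R n)))) * (D n / l (R n)) * k (t n * D n) =
       exponent_quotient f l (t n) (R n) z) F"
    proof eventually_elim
      case (elim n)
      then have nz: "D n \<noteq> 0" "t n \<noteq> 0" "l (R n) \<noteq> 0" by auto
      have e2: "exp (- (t n * f (2 * (R n * z)))) = exp (- (t n * f (R n * z))) * exp (- (t n * D n))"
        by (simp add: D_def exp_add[symmetric] algebra_simps)
      have e1: "exp (- (t n * (f (R n * z) - f (R n)))) = exp (- (t n * f (R n * z))) / exp (- (t n * f (R n)))"
        by (simp add: exp_diff[symmetric] algebra_simps)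
      have kk: "k (t n * D n) = (1 - exp (- (t n * D n))) / (t n * D n)" using nz by (simp add: k_def)
      show ?case unfolding exponent_quotient_def decay_weight_def e1 e2 kk using nz by (simp add: field_simps)
    qed
  qed
qed

text \<open>Dominated convergence yields limits along sequences, while the estimate needs thresholds
  uniform in \<open>t\<close> and \<open>R\<close>. If none worked, the thresholds
  \<open>1 / (n + 1)\<close> and \<open>n + 1\<close> would produce a sequence violating the
  limit.\<close>

lemma joint_limit_from_sequences:
  fixes G :: "real \<Rightarrow> real \<Rightarrow> real"
  assumes "\<And>t R. \<lbrakk>\<And>n. 0 < t n; t \<longlonglongrightarrow> 0; filterlim R at_top sequentially\<rbrakk> \<Longrightarrow> (\<lambda>n. G (t n) (R n)) \<longlonglongrightarrow> L"
    and \<epsilon>: "\<epsilon> > 0"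
  shows "\<exists>t0>0. \<exists>R0>0. \<forall>t R. 0 < t \<and> t < t0 \<and> R \<ge> R0 \<longrightarrow> \<bar>G t R - L\<bar> < \<epsilon>"
proof (rule ccontr)
  assume neg: "\<not> ?thesis"
  have "\<exists>t R. 0 < t \<and> t < 1 / real (Suc n) \<and> R \<ge> real (Suc n) \<and> \<bar>G t R - L\<bar> \<ge> \<epsilon>" for n
  proof (rule ccontr)
    assume "\<not> ?thesis"
    then have "\<exists>t0>0. \<exists>R0>0. \<forall>t R. 0 < t \<and> t < t0 \<and> R \<ge> R0 \<longrightarrow> \<bar>G t R - L\<bar> < \<epsilon>"
      by - (rule exI[where x="1 / real (Suc n)"], rule conjI, simp, rule exI[where x="real (Suc n)"], rule conjI, simp, meson not_le)
    with neg show False by blast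
  qed
  then obtain t R where tR: "\<And>n. 0 < t n" "\<And>n. t n < 1 / real (Suc n)" "\<And>n. R n \<ge> real (Suc n)"
    "\<And>n. \<bar>G (t n) (R n) - L\<bar> \<ge> \<epsilon>" by metis
  have "t \<longlonglongrightarrow> 0"
    by (rule tendsto_sandwich[OF _ _ tendsto_const LIMSEQ_inverse_real_of_nat])
      (use tR(1,2) in \<open>auto simp: less_imp_le inverse_eq_divide\<close>)
  moreover have "filterlim R at_top sequentially"
    by (rule filterlim_at_top_mono[OF filterlim_real_sequentially])
      (use order_trans[OF _ tR(3)] in \<open>simp add: always_eventually\<close>)
  ultimately have "(\<lambda>n. G (t n) (R n)) \<longlonglongrightarrow> L" using tR(1) by (intro assms(1))
  then have "eventually (\<lambda>n. \<bar>G (t n) (R n) - L\<bar> < \<epsilon>) sequentially"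
    using \<epsilon> by (auto simp: tendsto_iff dist_real_def)
  then show False using tR(4) by (auto simp: eventually_sequentially not_less[symmetric])
qed

text \<open>The ratio tends to 1 jointly in \<open>t\<close> and \<open>R\<close>; 2 stands for any
  constant above 1. It allows window averages at different scales to be measured by one
  weight.\<close>

lemma decay_weight_ratio:
  fixes f l :: "real \<Rightarrow> real"
  assumes sv: "slowly_varying_inf l"
    and bdd: "\<exists>B a. \<forall>x\<ge>a. \<bar>l x\<bar> \<le> B"
    and dh: "deHaan_inf l f" and c: "c > 0"
  shows "\<exists>t0>0. \<exists>R0>0. \<forall>t R. 0 < t \<and> t < t0 \<and> R \<ge> R0 \<longrightarrow> decay_weight f l t (R * c) \<le> 2 * decay_weight f l t R"
proof -
  have "\<exists>t0>0. \<exists>R0>0. \<forall>t R. 0 < t \<and> t < t0 \<and> R \<ge> R0 \<longrightarrow> \<bar>decay_weight f l t (R * c) / decay_weight f l t R - 1\<bar> < 1"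
  proof (rule joint_limit_from_sequences)
    fix t R :: "nat \<Rightarrow> real"
    assume t: "\<And>n. 0 < t n" "t \<longlonglongrightarrow> 0" and R: "filterlim R at_top sequentially"
    have "((\<lambda>x. l (c * x) / l x) \<longlongrightarrow> 1) at_top" using sv c by (simp add: slowly_varying_inf_def)
    from filterlim_compose[OF this R]
    have "(\<lambda>n. l (R n * c) / l (R n) * exp (- (t n * (f (R n * c) - f (R n))))) \<longlonglongrightarrow> 1 * exp (- 0)"
      by (intro tendsto_intros deHaan_small_increment_tendsto_0[OF sv bdd dh t(2) R c]) (simp add: mult.commute)
    moreover have "decay_weight f l (t n) (R n * c) / decay_weight f l (t n) (R n) =
        l (R n * c) / l (R n) * exp (- (t n * (f (R n * c) - f (R n))))" for n
      using t(1)[of n] by (simp add: decay_weight_def right_diff_distrib exp_diff exp_minus field_simps)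
    ultimately show "(\<lambda>n. decay_weight f l (t n) (R n * c) / decay_weight f l (t n) (R n)) \<longlonglongrightarrow> 1" by simp
  qed simp
  then obtain t0 R0 where tR: "t0 > 0" "R0 > 0"
    "\<And>t R. \<lbrakk>0 < t; t < t0; R \<ge> R0\<rbrakk> \<Longrightarrow> \<bar>decay_weight f l t (R * c) / decay_weight f l t R - 1\<bar> < 1" by blast
  obtain a where a: "\<And>x. x \<ge> a \<Longrightarrow> 0 < l x" using sv by (auto simp: slowly_varying_inf_def)
  show ?thesis
  proof (rule exI[of _ t0], rule conjI[OF tR(1)], rule exI[of _ "max R0 a"], intro conjI allI impI)
    fix t R assume *: "0 < t \<and> t < t0 \<and> R \<ge> max R0 a"
    then have "0 < decay_weight f l t R" using a by (simp add: decay_weight_def)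
    moreover have "decay_weight f l t (R * c) / decay_weight f l t R < 2" using tR(3)[of t R] * by (simp add: abs_less_iff)
    ultimately show "decay_weight f l t (R * c) \<le> 2 * decay_weight f l t R" by (simp add: field_simps)
  qed (use tR in auto)
qed

section \<open>The Gaussian window\<close>

text \<open>The Gaussian factor is the characteristic function of a standard Gaussian vector at
  \<open>R *\<^sub>R x\<close>, and the pairing is symmetric in the two vectors. Fubini applies
  because the integrand has modulus 1 and both measures are probabilities.\<close>

lemma gaussian_transform_duality:
  fixes \<mu> :: "'a::euclidean_space measure"
  assumes "prob_space \<mu>" and sets: "sets \<mu> = sets borel"
    and char: "\<And>\<xi>. (\<integral>x. cis (\<xi> \<bullet> x) \<partial>\<mu>) = complex_of_real (\<phi> \<xi>)"
  shows "(\<integral>x. exp (- (R * norm x)\<^sup>2 / 2) \<partial>\<mu>) = (\<integral>z. \<phi> (R *\<^sub>R z) \<partial>std_gaussian)"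
proof -
  interpret \<mu>: prob_space \<mu> by fact
  interpret \<gamma>: prob_space "std_gaussian :: 'a measure" by (rule prob_space_std_gaussian)
  interpret P: pair_prob_space \<mu> "std_gaussian :: 'a measure" ..
  note [measurable_cong] = sets
  have [measurable]: "cis \<in> borel_measurable borel"
    by (intro borel_measurable_continuous_onI continuous_intros)
  have int: "integrable (\<mu> \<Otimes>\<^sub>M std_gaussian) (\<lambda>(x, z). cis ((R *\<^sub>R x) \<bullet> z))"
    by (rule P.integrable_const_bound[of _ 1]) (auto simp: split_beta)
  have "complex_of_real (\<integral>x. exp (- (R * norm x)\<^sup>2 / 2) \<partial>\<mu>)
      = (\<integral>x. (\<integral>z. cis ((R *\<^sub>R x) \<bullet> z) \<partial>std_gaussian) \<partial>\<mu>)"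
    unfolding characteristic_std_gaussian by (simp add: power_mult_distrib)
  also have "\<dots> = (\<integral>z. (\<integral>x. cis ((R *\<^sub>R x) \<bullet> z) \<partial>\<mu>) \<partial>std_gaussian)"
    by (rule P.Fubini_integral[OF int, symmetric])
  also have "\<dots> = (\<integral>z. (\<integral>x. cis ((R *\<^sub>R z) \<bullet> x) \<partial>\<mu>) \<partial>std_gaussian)"
    by (simp add: inner_commute)
  also have "\<dots> = complex_of_real (\<integral>z. \<phi> (R *\<^sub>R z) \<partial>std_gaussian)"
    unfolding char by simp
  finally show ?thesis by (simp only: of_real_eq_iff)
qed

text \<open>The second term is the first at the doubled argument, matching the duality at the scales
  \<open>R\<close> and \<open>2 * R\<close>. Small at both ends, it localises
  \<open>R * norm x\<close>.\<close>

definition gauss_window :: "real \<Rightarrow> real" where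
  "gauss_window u = exp (- u\<^sup>2 / 2) - exp (- (2 * u)\<^sup>2 / 2)"

lemma gauss_window_factor: "gauss_window u = exp (- u\<^sup>2 / 2) * (1 - exp (- (3 * u\<^sup>2 / 2)))"
  by (simp add: gauss_window_def right_diff_distrib exp_add[symmetric] power_mult_distrib)

lemma gauss_window_measurable [measurable]: "gauss_window \<in> borel_measurable borel"
  unfolding gauss_window_def[abs_def] by measurable

lemma gauss_window_nonneg: "0 \<le> gauss_window u"
  by (simp add: gauss_window_factor)

lemma gauss_window_le_exp: "gauss_window u \<le> exp (- u\<^sup>2 / 2)"
  by (simp add: gauss_window_def)

lemma gauss_window_le_1: "gauss_window u \<le> 1"
  by (rule order_trans[OF gauss_window_le_exp]) simp

text \<open>The constant is \<open>1/2 * 2/5 * 3/2\<close>: the Gaussian factor is at least 1/2, and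
  \<open>1 - exp (- y) \<ge> 2/5 * y\<close> for \<open>y = 3 * w^2 / 2\<close>.\<close>

lemma gauss_window_ge_quadratic:
  assumes "0 \<le> w" "w \<le> 1"
  shows "3 / 10 * w\<^sup>2 \<le> gauss_window w"
proof -
  have w: "w\<^sup>2 \<le> 1" using assms by (simp add: power_le_one)
  define y where "y = 3 * w\<^sup>2 / 2"
  have y: "0 \<le> y" "y \<le> 3 / 2" using w by (auto simp: y_def)
  have "exp (- y) \<le> 1 / (1 + y)"
  proof -
    have "1 + y \<le> exp y" by (rule exp_ge_add_one_self)
    then show ?thesis using y by (simp add: exp_minus inverse_eq_divide frac_le)
  qed
  also have "\<dots> \<le> 1 - 2 / 5 * y"
  proof -
    \<comment> \<open>The slope 2/5 is the one fitting \<open>y \<le> 3/2\<close>: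
      \<open>(1 - 2/5 * y) * (1 + y) = 1 + 2/5 * y * (3/2 - y)\<close>.\<close>
    have "0 \<le> y * (3 / 2 - y)" using y by simp
    then have "1 \<le> (1 - 2 / 5 * y) * (1 + y)" by (simp add: algebra_simps)
    then show ?thesis using y by (simp add: pos_divide_le_eq)
  qed
  finally have 1: "2 / 5 * y \<le> 1 - exp (- y)" by simp
  have 2: "1 / 2 \<le> exp (- w\<^sup>2 / 2)" using exp_ge_add_one_self[of "- w\<^sup>2 / 2"] w by linarith
  have "1 / 2 * (2 / 5 * y) \<le> exp (- w\<^sup>2 / 2) * (1 - exp (- y))"
    using 1 2 y by (intro mult_mono) auto
  then show ?thesis by (simp add: gauss_window_factor y_def)
qed

text \<open>On the unit interval the window lies between 3/10 and 3/2 times the square; the ratio of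
  these constants is 5, and dilation gains \<open>M^2\<close>.\<close>

lemma gauss_window_le_dilated:
  assumes "M > 0" "0 \<le> u" "M * u \<le> 1"
  shows "gauss_window u \<le> 5 / M\<^sup>2 * gauss_window (M * u)"
proof -
  have "gauss_window u \<le> 3 / 2 * u\<^sup>2"
    using exp_minus_diff_bound[of 0 "u\<^sup>2 / 2" "(2 * u)\<^sup>2 / 2"]
    by (simp add: gauss_window_def power_mult_distrib abs_if split: if_splits)
  also have "\<dots> = 5 / M\<^sup>2 * (3 / 10 * (M * u)\<^sup>2)" using assms by (simp add: power_mult_distrib field_simps)
  also have "\<dots> \<le> 5 / M\<^sup>2 * gauss_window (M * u)"
    using assms by (intro mult_left_mono gauss_window_ge_quadratic) auto
  finally show ?thesis .
qed

text \<open>Split \<open>u^2 / 2\<close> into \<open>15 * u^2 / 32\<close> and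
  \<open>(u / 4)^2 / 2\<close>. The Gaussian of the second part is at most twice the window at
  \<open>u / 4\<close>; that of the first gives the gain \<open>4 / A^2\<close> through
  \<open>x \<le> exp x\<close>.\<close>

lemma gauss_window_le_contracted:
  assumes A: "A \<ge> 4" and u: "u \<ge> A"
  shows "gauss_window u \<le> 8 / A\<^sup>2 * gauss_window (u / 4)"
proof -
  have u2: "A\<^sup>2 \<le> u\<^sup>2" using A u by (intro power_mono) auto
  have A2: "16 \<le> A\<^sup>2" using power_mono[of 4 A 2] A by simp
  have half: "1 / 2 \<le> 1 - exp (- (3 * (u / 4)\<^sup>2 / 2))"
  proof -
    have "1 + 3 * (u / 4)\<^sup>2 / 2 \<le> exp (3 * (u / 4)\<^sup>2 / 2)" by (rule exp_ge_add_one_self)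
    moreover have "1 \<le> 3 * (u / 4)\<^sup>2 / 2" using u2 A2 by (simp add: power_divide)
    ultimately have "2 \<le> exp (3 * (u / 4)\<^sup>2 / 2)" by linarith
    then show ?thesis by (simp add: exp_minus inverse_eq_divide pos_divide_le_eq)
  qed
  have dec: "exp (- (15 * u\<^sup>2 / 32)) \<le> 4 / A\<^sup>2"
  proof -
    have "15 * u\<^sup>2 / 32 \<le> exp (15 * u\<^sup>2 / 32)" using exp_ge_add_one_self[of "15 * u\<^sup>2 / 32"] by linarith
    then have "A\<^sup>2 / 4 \<le> exp (15 * u\<^sup>2 / 32)" using u2 A2 by linarith
    then show ?thesis using A by (simp add: exp_minus field_simps)
  qed
  have "gauss_window u \<le> exp (- u\<^sup>2 / 2)" by (rule gauss_window_le_exp)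
  also have "\<dots> = exp (- (15 * u\<^sup>2 / 32)) * (2 * (exp (- (u / 4)\<^sup>2 / 2) * (1 / 2)))"
    by (simp add: exp_add[symmetric] power_divide)
  also have "\<dots> \<le> 4 / A\<^sup>2 * (2 * gauss_window (u / 4))"
    unfolding gauss_window_factor[of "u / 4"] using half dec by (intro mult_mono) auto
  finally show ?thesis by simp
qed

section \<open>Passing between the mass of a shell and the density\<close>

text \<open>With \<open>x\<close> on the outer sphere the density is at least \<open>p x\<close> on
  the shell, which fills at least half of the ball since \<open>(1/2) ^ DIM('a) \<le> 1/2\<close>.
  The shell misses the origin and a possible atom there.\<close>

lemma shell_mass_ge:
  fixes \<mu> :: "'a::euclidean_space measure"
  assumes "prob_space \<mu>" and sets: "sets \<mu> = sets borel"
    and nonneg: "\<And>y. 0 \<le> p y"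
    and dens: "\<And>A. A \<in> sets borel \<Longrightarrow> emeasure \<mu> (A - {0}) = (\<integral>\<^sup>+y\<in>A - {0}. ennreal (p y) \<partial>lborel)"
    and mono: "\<And>x y. x \<noteq> 0 \<Longrightarrow> norm x \<le> norm y \<Longrightarrow> p y \<le> p x"
    and x: "x \<noteq> 0"
  shows "p x * (unit_ball_vol (real DIM('a)) * norm x ^ DIM('a) / 2) \<le>
    measure \<mu> {y. norm x / 2 \<le> norm y \<and> norm y \<le> norm x}"
proof -
  interpret prob_space \<mu> by fact
  define V where "V = unit_ball_vol (real DIM('a))"
  have V: "V \<ge> 0" unfolding V_def by simp
  define A :: "'a set" where "A = {y. norm x / 2 \<le> norm y \<and> norm y \<le> norm x}"
  have Aeq: "A = cball 0 (norm x) - ball 0 (norm x / 2)" by (auto simp: A_def)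
  have A[measurable]: "A \<in> sets borel" unfolding Aeq by simp
  have A0: "A - {0} = A" using x by (auto simp: A_def)
  have "emeasure lborel A = emeasure lborel (cball (0::'a) (norm x)) - emeasure lborel (ball (0::'a) (norm x / 2))"
    unfolding Aeq using subset_trans[OF ball_subset_cball subset_cball, of "norm x / 2" "norm x" "0::'a"]
    by (subst emeasure_Diff) (simp_all add: emeasure_ball)
  also have "\<dots> = ennreal (V * norm x ^ DIM('a) - V * (norm x / 2) ^ DIM('a))"
    unfolding V_def by (subst emeasure_cball, simp, subst emeasure_ball, simp, subst ennreal_minus) auto
  also have "V * norm x ^ DIM('a) - V * (norm x / 2) ^ DIM('a) = V * norm x ^ DIM('a) * (1 - (1 / 2) ^ DIM('a))"
    by (simp add: power_divide algebra_simps)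
  finally have vol: "emeasure lborel A = ennreal (V * norm x ^ DIM('a) * (1 - (1 / 2) ^ DIM('a)))" .
  have "(1 / 2 :: real) ^ DIM('a) \<le> (1 / 2) ^ 1" using DIM_positive[where 'a='a] by (intro power_decreasing) auto
  then have "V * norm x ^ DIM('a) / 2 \<le> V * norm x ^ DIM('a) * (1 - (1 / 2) ^ DIM('a))"
    using V mult_left_mono[of "1 / 2" "1 - (1 / 2) ^ DIM('a)" "V * norm x ^ DIM('a)"] by simp
  then have "ennreal (p x * (V * norm x ^ DIM('a) / 2)) \<le> ennreal (p x * (V * norm x ^ DIM('a) * (1 - (1 / 2) ^ DIM('a))))"
    using nonneg by (intro ennreal_leI mult_left_mono) auto
  also have "\<dots> = ennreal (p x) * emeasure lborel A"
    unfolding vol using nonneg by (subst ennreal_mult') auto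
  also have "\<dots> = (\<integral>\<^sup>+y. ennreal (p x) * indicator A y \<partial>lborel)"
    by (simp add: nn_integral_cmult)
  also have "\<dots> \<le> (\<integral>\<^sup>+y\<in>A - {0}. ennreal (p y) \<partial>lborel)"
    unfolding A0
  proof (rule nn_integral_mono)
    fix y show "ennreal (p x) * indicator A y \<le> ennreal (p y) * indicator A y"
      using mono[of y x] x by (cases "y = 0") (auto simp: A_def indicator_def intro!: ennreal_leI)
  qed
  also have "\<dots> = emeasure \<mu> A" using dens[OF A] by (simp add: A0)
  also have "\<dots> = ennreal (measure \<mu> A)" by (rule emeasure_eq_measure)
  finally show ?thesis by (simp add: A_def V_def)
qed

text \<open>Here \<open>x\<close> lies on the inner sphere, so the density is at most
  \<open>p x\<close> on the shell, whose volume is bounded by that of the full ball.\<close>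

lemma shell_mass_le:
  fixes \<mu> :: "'a::euclidean_space measure"
  assumes "prob_space \<mu>" and sets: "sets \<mu> = sets borel"
    and nonneg: "\<And>y. 0 \<le> p y"
    and dens: "\<And>A. A \<in> sets borel \<Longrightarrow> emeasure \<mu> (A - {0}) = (\<integral>\<^sup>+y\<in>A - {0}. ennreal (p y) \<partial>lborel)"
    and mono: "\<And>x y. x \<noteq> 0 \<Longrightarrow> norm x \<le> norm y \<Longrightarrow> p y \<le> p x"
    and x: "x \<noteq> 0" and b: "b \<ge> 0"
  shows "measure \<mu> {y. norm x \<le> norm y \<and> norm y \<le> b} \<le> p x * (unit_ball_vol (real DIM('a)) * b ^ DIM('a))"
proof -
  interpret prob_space \<mu> by fact
  define A :: "'a set" where "A = {y. norm x \<le> norm y \<and> norm y \<le> b}"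
  have Aeq: "A = cball 0 b - ball 0 (norm x)" by (auto simp: A_def)
  have A[measurable]: "A \<in> sets borel" unfolding Aeq by simp
  have A0: "A - {0} = A" using x by (auto simp: A_def)
  have "ennreal (measure \<mu> A) = (\<integral>\<^sup>+y\<in>A - {0}. ennreal (p y) \<partial>lborel)"
    using dens[OF A] by (simp add: A0 emeasure_eq_measure)
  also have "\<dots> \<le> (\<integral>\<^sup>+y. ennreal (p x) * indicator (cball (0::'a) b) y \<partial>lborel)"
    unfolding A0 using x mono by (intro nn_integral_mono) (auto simp: A_def indicator_def intro!: ennreal_leI)
  also have "\<dots> = ennreal (p x) * emeasure lborel (cball (0::'a) b)"
    by (rule nn_integral_cmult_indicator) simp
  also have "\<dots> = ennreal (p x * (unit_ball_vol (real DIM('a)) * b ^ DIM('a)))"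
    using nonneg b by (subst emeasure_cball) (auto simp: ennreal_mult')
  finally show ?thesis using nonneg b by (simp add: A_def)
qed

section \<open>Regularity of the exponent and asymptotics of the window average\<close>

text \<open>Along the chosen direction \<open>e\<close>, \<open>exp (- radial psi r)\<close> is the
  characteristic function of the real variable \<open>e \<bullet> Y\<close>: continuous, positive,
  and of modulus at most 1. Taking logarithms gives both claims without estimating the Levy
  integral.\<close>

lemma exponent_regularity:
  fixes Y :: "'b \<Rightarrow> 'a::euclidean_space" and psi :: "'a \<Rightarrow> real"
  assumes "prob_space M" and [measurable]: "Y \<in> borel_measurable M"
    and char: "\<And>\<xi>. (\<integral>\<omega>. cis (\<xi> \<bullet> Y \<omega>) \<partial>M) = complex_of_real (exp (- psi \<xi>))"
  shows "continuous_on UNIV (radial psi)" and "0 \<le> radial psi r"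
proof -
  interpret prob_space M by fact
  define e :: 'a where "e = (SOME e::'a. norm e = 1)"
  define D where "D = distr M borel (\<lambda>\<omega>. e \<bullet> Y \<omega>)"
  interpret D: real_distribution D unfolding D_def by (rule real_distribution_distr) simp
  have D: "Characteristic_Functions.char D r = complex_of_real (exp (- radial psi r))" for r
  proof -
    have "Characteristic_Functions.char D r = (\<integral>\<omega>. iexp (r * (e \<bullet> Y \<omega>)) \<partial>M)"
      unfolding Characteristic_Functions.char_def D_def by (rule integral_distr) simp_all
    also have "\<dots> = (\<integral>\<omega>. cis ((r *\<^sub>R e) \<bullet> Y \<omega>) \<partial>M)" by (simp add: cis_conv_exp)
    finally show ?thesis unfolding char by (simp add: radial_def e_def)
  qed
  have "radial psi = (\<lambda>r. - ln (Re (Characteristic_Functions.char D r)))" by (simp add: D)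
  moreover have "continuous_on UNIV (\<lambda>r. - ln (Re (Characteristic_Functions.char D r)))"
    by (intro continuous_intros continuous_at_imp_continuous_on ballI D.isCont_char) (simp add: D)
  ultimately show "continuous_on UNIV (radial psi)" by simp
  show "0 \<le> radial psi r" using D.cmod_char_le_1[of r] by (simp add: D)
qed

lemma gaussian_quotient_limit:
  fixes f l :: "real \<Rightarrow> real"
  assumes cont: "continuous_on UNIV f" and nonneg: "\<And>x. 0 \<le> f x"
    and sv: "slowly_varying_inf l"
    and bdd: "\<exists>B a. \<forall>x\<ge>a. \<bar>l x\<bar> \<le> B"
    and dh: "deHaan_inf l f"
    and t: "\<And>n. 0 < t n" "t \<longlonglongrightarrow> 0" and R: "filterlim R at_top sequentially"
  shows "(\<lambda>n. \<integral>z. exponent_quotient f l (t n) (R n) (norm z) \<partial>(std_gaussian :: 'a::euclidean_space measure)) \<longlonglongrightarrow> ln 2"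
proof -
  interpret \<gamma>: prob_space "std_gaussian :: 'a measure" by (rule prob_space_std_gaussian)
  obtain C t1 R1 where t1: "t1 > 0" and
    bound: "\<And>t R z. \<lbrakk>0 < t; t \<le> t1; R \<ge> R1; z > 0\<rbrakk> \<Longrightarrow> \<bar>exponent_quotient f l t R z\<bar> \<le> C * exp (\<bar>ln z\<bar> / 2)"
    using exponent_quotient_bound[OF cont nonneg sv bdd dh] by metis
  have [measurable]: "f \<in> borel_measurable borel" by (rule borel_measurable_continuous_onI[OF cont])
  have "eventually (\<lambda>n. t n \<le> t1 \<and> R n \<ge> R1) sequentially"
    using order_tendstoD(2)[OF t(2) t1] R[unfolded filterlim_at_top, rule_format, of R1]
    by eventually_elim auto
  then obtain N where N: "\<And>n. n \<ge> N \<Longrightarrow> t n \<le> t1 \<and> R n \<ge> R1" by (auto simp: eventually_sequentially)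
  obtain b0 :: 'a where b0: "b0 \<in> Basis" using SOME_Basis by blast
  have nz: "AE z::'a in std_gaussian. norm z > 0"
    using AE_std_gaussian_nonzero[OF b0] by eventually_elim auto
  \<comment> \<open>The majorant is valid only from index \<open>N\<close> on, hence the shifted
    sequence.\<close>
  have "(\<lambda>n. \<integral>z. exponent_quotient f l (t (n + N)) (R (n + N)) (norm z) \<partial>(std_gaussian :: 'a measure))
      \<longlonglongrightarrow> (\<integral>z. ln 2 \<partial>(std_gaussian :: 'a measure))"
  proof (rule integral_dominated_convergence)
    show "integrable std_gaussian (\<lambda>z::'a. C * exp (\<bar>ln (norm z)\<bar> / 2))"
      by (intro integrable_mult_right integrable_std_gaussian_dominant)
    show "AE z::'a in std_gaussian. (\<lambda>n. exponent_quotient f l (t (n + N)) (R (n + N)) (norm z)) \<longlonglongrightarrow> ln 2"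
      using nz
    proof eventually_elim
      fix z :: 'a assume "norm z > 0"
      then have "(\<lambda>n. exponent_quotient f l (t n) (R n) (norm z)) \<longlonglongrightarrow> ln 2"
        using t by (intro exponent_quotient_tendsto[OF sv bdd dh _ _ R]) auto
      then show "(\<lambda>n. exponent_quotient f l (t (n + N)) (R (n + N)) (norm z)) \<longlonglongrightarrow> ln 2"
        by (rule LIMSEQ_ignore_initial_segment)
    qed
    show "AE z::'a in std_gaussian. norm (exponent_quotient f l (t (n + N)) (R (n + N)) (norm z)) \<le> C * exp (\<bar>ln (norm z)\<bar> / 2)" for n
      using nz by eventually_elim (use N[of "n + N"] t(1) in \<open>auto intro!: bound\<close>)
  qed (simp_all add: exponent_quotient_def)
  then have "(\<lambda>n. \<integral>z. exponent_quotient f l (t (n + N)) (R (n + N)) (norm z) \<partial>(std_gaussian :: 'a measure)) \<longlonglongrightarrow> ln 2"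
    using \<gamma>.prob_space by simp
  then show ?thesis by (rule LIMSEQ_offset)
qed

lemma gauss_window_expectation:
  fixes \<mu> :: "'a::euclidean_space measure" and f :: "real \<Rightarrow> real"
  assumes "prob_space \<mu>" and sets: "sets \<mu> = sets borel"
    and char: "\<And>\<xi>. (\<integral>x. cis (\<xi> \<bullet> x) \<partial>\<mu>) = complex_of_real (exp (- (t * f (norm \<xi>))))"
    and cont: "continuous_on UNIV f" and nonneg: "\<And>x. 0 \<le> f x" and t: "t \<ge> 0" and R: "R \<ge> 0"
  shows "(\<integral>x. gauss_window (R * norm x) \<partial>\<mu>) / decay_weight f l t R
    = (\<integral>z. exponent_quotient f l t R (norm z) \<partial>(std_gaussian :: 'a measure))"
proof -
  interpret \<mu>: prob_space \<mu> by fact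
  interpret \<gamma>: prob_space "std_gaussian :: 'a measure" by (rule prob_space_std_gaussian)
  note [measurable_cong] = sets
  have [measurable]: "f \<in> borel_measurable borel" by (rule borel_measurable_continuous_onI[OF cont])
  have i1: "integrable \<mu> (\<lambda>x. exp (- (S * norm x)\<^sup>2 / 2))" for S
    by (rule \<mu>.integrable_const_bound[of _ 1]) auto
  have i2: "integrable std_gaussian (\<lambda>z::'a. exp (- (t * f (S * norm z))))" for S
    by (rule \<gamma>.integrable_const_bound[of _ 1]) (use t nonneg in auto)
  have dual: "(\<integral>x. exp (- (S * norm x)\<^sup>2 / 2) \<partial>\<mu>) = (\<integral>z. exp (- (t * f (S * norm z))) \<partial>(std_gaussian :: 'a measure))"
    if "S \<ge> 0" for S
    using gaussian_transform_duality[OF assms(1) sets char, of S] that by simp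
  have "(\<integral>x. gauss_window (R * norm x) \<partial>\<mu>)
      = (\<integral>x. exp (- (R * norm x)\<^sup>2 / 2) - exp (- (2 * R * norm x)\<^sup>2 / 2) \<partial>\<mu>)"
    by (simp add: gauss_window_def mult.assoc)
  also have "\<dots> = (\<integral>z. exp (- (t * f (R * norm z))) \<partial>(std_gaussian :: 'a measure))
      - (\<integral>z. exp (- (t * f (2 * R * norm z))) \<partial>(std_gaussian :: 'a measure))"
    using R by (subst Bochner_Integration.integral_diff[OF i1 i1]) (simp only: dual mult_nonneg_nonneg zero_le_numeral)
  also have "\<dots> = (\<integral>z. exp (- (t * f (R * norm z))) - exp (- (t * f (2 * R * norm z))) \<partial>(std_gaussian :: 'a measure))"
    by (rule Bochner_Integration.integral_diff[OF i2 i2, symmetric])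
  finally show ?thesis by (simp add: exponent_quotient_def mult.assoc)
qed

section \<open>The two-sided estimate\<close>

theorem mainTheorem17:
  fixes M :: "'b measure" and X :: "real \<Rightarrow> 'b \<Rightarrow> 'a::euclidean_space"
    and g :: "real \<Rightarrow> real" and psi :: "'a \<Rightarrow> real" and p :: "real \<Rightarrow> 'a \<Rightarrow> real"
    and l :: "real \<Rightarrow> real"
  assumes "isotropic_unimodal_levy M X g psi p"
    and "slowly_varying_inf l"
    and "\<exists>B a. \<forall>x\<ge>a. \<bar>l x\<bar> \<le> B"
    and "deHaan_inf l (radial psi)"
  shows "\<exists>r0>0. \<exists>t0>0. \<exists>C\<ge>1. \<forall>t x. 0 < t \<and> t < t0 \<and> 0 < norm x \<and> norm x \<le> r0 \<longrightarrow>
           inverse C * (t / norm x ^ DIM('a) * l (inverse (norm x))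
              * exp (- (t * radial psi (inverse (norm x))))) \<le> p t x \<and>
           p t x \<le> C * (t / norm x ^ DIM('a) * l (inverse (norm x))
              * exp (- (t * radial psi (inverse (norm x)))))"
proof -
  note sv = assms(2) and bdd = assms(3) and dh = assms(4)
  have levy: "levy_process M X"
    and int: "integrable lborel (\<lambda>x::'a. min 1 ((norm x)\<^sup>2) * g (norm x))"
    and psi: "\<And>\<xi>. psi \<xi> = (\<integral>x. (1 - cos (\<xi> \<bullet> x)) * g (norm x) \<partial>lborel)"
    and char: "\<And>t \<xi>. t \<ge> 0 \<Longrightarrow> (\<integral>\<omega>. cis (\<xi> \<bullet> X t \<omega>) \<partial>M) = complex_of_real (exp (- (t * psi \<xi>)))"
    and p0: "\<And>t x. t > 0 \<Longrightarrow> 0 \<le> p t x"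
    and dens: "\<And>t A. t > 0 \<Longrightarrow> A \<in> sets borel \<Longrightarrow> emeasure (distr M borel (X t)) (A - {0})
                          = (\<integral>\<^sup>+x\<in>A - {0}. ennreal (p t x) \<partial>lborel)"
    and mono: "\<And>t x y. t > 0 \<Longrightarrow> x \<noteq> 0 \<Longrightarrow> norm x \<le> norm y \<Longrightarrow> p t y \<le> p t x"
    using assms(1) unfolding isotropic_unimodal_levy_def by blast+
  interpret M: prob_space M using levy by (simp add: levy_process_def)
  have X[measurable]: "X t \<in> borel_measurable M" if "t \<ge> 0" for t
    using levy that by (simp add: levy_process_def)
  define f where "f = radial psi"
  have rad: "psi \<xi> = f (norm \<xi>)" for \<xi> unfolding f_def by (rule radial_exponent[OF int psi])
  \<comment> \<open>Time 1 suffices, since \<open>exp (- psi)\<close> is the characteristic function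
    of \<open>X 1\<close>.\<close>
  have f_cont: "continuous_on UNIV f" and f_nonneg: "\<And>x. 0 \<le> f x"
    unfolding f_def using exponent_regularity[OF M.prob_space_axioms X[of 1], of psi] char[of 1] by simp_all
  define \<mu> where "\<mu> t = distr M borel (X t)" for t
  have sets_\<mu>[measurable_cong]: "sets (\<mu> t) = sets borel" for t by (simp add: \<mu>_def)
  have \<mu>: "prob_space (\<mu> t)" if "t \<ge> 0" for t
    unfolding \<mu>_def by (rule M.prob_space_distr) (rule X[OF that])
  have [measurable]: "cis \<in> borel_measurable borel"
    by (intro borel_measurable_continuous_onI continuous_intros)
  have char_\<mu>: "(\<integral>x. cis (\<xi> \<bullet> x) \<partial>\<mu> t) = complex_of_real (exp (- (t * f (norm \<xi>))))" if "t \<ge> 0" for t \<xi>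
    unfolding \<mu>_def using X[OF that] by (subst integral_distr) (simp_all add: char[OF that] rad)
  define I where "I t R = (\<integral>x. gauss_window (R * norm x) \<partial>\<mu> t)" for t R
  define w where "w = decay_weight f l"
  have dh': "deHaan_inf l f" unfolding f_def by (rule dh)
  \<comment> \<open>The tolerance \<open>ln 2 / 2\<close> keeps the limit away from 0 and produces
    the factors 1/2 and 3/2 in \<open>I\<close>.\<close>
  have "\<exists>t0>0. \<exists>R0>0. \<forall>t R. 0 < t \<and> t < t0 \<and> R \<ge> R0 \<longrightarrow>
      \<bar>(\<integral>z. exponent_quotient f l t R (norm z) \<partial>(std_gaussian :: 'a measure)) - ln 2\<bar> < ln 2 / 2"
    by (rule joint_limit_from_sequences[OF gaussian_quotient_limit[OF f_cont f_nonneg sv bdd dh']]) simp_all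
  then obtain t1 R1 where t1: "t1 > 0" "R1 > 0" and lim: "\<And>t R. \<lbrakk>0 < t; t < t1; R \<ge> R1\<rbrakk> \<Longrightarrow>
      \<bar>(\<integral>z. exponent_quotient f l t R (norm z) \<partial>(std_gaussian :: 'a measure)) - ln 2\<bar> < ln 2 / 2" by blast
  obtain a where a: "\<And>x. x \<ge> a \<Longrightarrow> 0 < l x" using sv by (auto simp: slowly_varying_inf_def)
  define R2 where "R2 = max R1 a"
  have R2: "R2 > 0" "R2 \<ge> R1" "R2 \<ge> a" using t1 by (auto simp: R2_def)
  have w_pos: "0 < w t R" if "0 < t" "R \<ge> R2" for t R
    using a[of R] that R2 by (simp add: w_def decay_weight_def)
  have I: "ln 2 / 2 * w t R \<le> I t R" "I t R \<le> 3 / 2 * ln 2 * w t R" if "0 < t" "t < t1" "R \<ge> R2" for t R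
  proof -
    have "I t R / w t R = (\<integral>z. exponent_quotient f l t R (norm z) \<partial>(std_gaussian :: 'a measure))"
      unfolding I_def w_def using that R2
      by (intro gauss_window_expectation[OF \<mu> sets_\<mu> char_\<mu> f_cont f_nonneg]) auto
    then have "\<bar>I t R / w t R - ln 2\<bar> < ln 2 / 2" using lim[of t R] that R2 by simp
    then have "ln 2 / 2 \<le> I t R / w t R" "I t R / w t R \<le> 3 / 2 * ln 2" by linarith+
    then show "ln 2 / 2 * w t R \<le> I t R" "I t R \<le> 3 / 2 * ln 2 * w t R"
      using w_pos[OF that(1,3)] by (simp_all add: pos_le_divide_eq pos_divide_le_eq)
  qed
  obtain t3 R3 where t3: "t3 > 0" "R3 > 0"
    and up: "\<And>t R. \<lbrakk>0 < t; t < t3; R \<ge> R3\<rbrakk> \<Longrightarrow> w t (R * 16) \<le> 2 * w t R"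
    using decay_weight_ratio[OF sv bdd dh', of 16] unfolding w_def by auto
  obtain t4 R4 where t4: "t4 > 0" "R4 > 0"
    and down: "\<And>t R. \<lbrakk>0 < t; t < t4; R \<ge> R4\<rbrakk> \<Longrightarrow> w t (R * (1 / 4)) \<le> 2 * w t R"
    using decay_weight_ratio[OF sv bdd dh', of "1 / 4"] unfolding w_def by auto
  define T where "T = min t1 (min t3 t4)"
  \<comment> \<open>\<open>4 * R2\<close> leaves room for using \<open>I\<close> at the smaller
    scale \<open>R * (1 / 4)\<close>.\<close>
  define S where "S = max (4 * R2) (max R3 R4)"
  have T: "T > 0" "T \<le> t1" "T \<le> t3" "T \<le> t4" using t1 t3 t4 by (auto simp: T_def)
  have S: "S > 0" "4 * R2 \<le> S" "R3 \<le> S" "R4 \<le> S" using R2 by (auto simp: S_def)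
  define V where "V = unit_ball_vol (real DIM('a))"
  have V: "V > 0" by (simp add: V_def)
  have upper: "p t x \<le> 40 * ln 2 / V * (w t (inverse (norm x)) / norm x ^ DIM('a))"
    if t: "0 < t" "t < T" and x: "x \<noteq> 0" and xR: "inverse (norm x) \<ge> S" for t x
  proof -
    interpret \<mu>: prob_space "\<mu> t" using \<mu> t by simp
    define R where "R = inverse (norm x)"
    define A where "A = {y::'a. norm x / 2 \<le> norm y \<and> norm y \<le> norm x}"
    have [measurable]: "A \<in> sets borel" unfolding A_def by measurable
    have "p t x * (V * norm x ^ DIM('a) / 2) \<le> measure (\<mu> t) A"
      unfolding V_def A_def using t
      by (intro shell_mass_ge[OF \<mu> sets_\<mu> p0 _ _ x] dens[folded \<mu>_def] mono) auto
    also have "measure (\<mu> t) A = (\<integral>y. indicator A y \<partial>\<mu> t)"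
      by simp
    \<comment> \<open>On \<open>A\<close> the window is at least
      \<open>3/10 * (1/2)^2 = 3/40\<close>.\<close>
    also have "\<dots> \<le> (\<integral>y. 40 / 3 * gauss_window (R * norm y) \<partial>\<mu> t)"
    proof (rule integral_mono)
      show "integrable (\<mu> t) (indicator A :: 'a \<Rightarrow> real)"
        by (rule \<mu>.integrable_const_bound[of _ 1]) (auto simp: indicator_def)
      show "integrable (\<mu> t) (\<lambda>y. 40 / 3 * gauss_window (R * norm y))"
        by (rule \<mu>.integrable_const_bound[of _ "40 / 3"]) (auto simp: gauss_window_nonneg gauss_window_le_1)
      fix y
      show "indicator A y \<le> 40 / 3 * gauss_window (R * norm y)"
      proof (cases "y \<in> A")
        case True
        then have Ry: "1 / 2 \<le> R * norm y" "R * norm y \<le> 1" using x by (auto simp: A_def R_def field_simps)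
        have "(1 / 2)\<^sup>2 \<le> (R * norm y)\<^sup>2" using Ry by (intro power_mono) auto
        then show ?thesis using gauss_window_ge_quadratic[of "R * norm y"] Ry True by (simp add: power2_eq_square)
      qed (simp add: gauss_window_nonneg)
    qed
    also have "\<dots> = 40 / 3 * I t R" by (simp add: I_def)
    also have "\<dots> \<le> 40 / 3 * (3 / 2 * ln 2 * w t R)"
      using I(2)[of t R] t T S xR R2 by (intro mult_left_mono) (auto simp: R_def)
    finally have "p t x * (V * norm x ^ DIM('a) / 2) \<le> 20 * ln 2 * w t R" by (simp add: mult_ac)
    then show ?thesis using V x by (simp add: R_def field_simps)
  qed
  have lower: "ln 2 / (8 * V * 256 ^ DIM('a)) * (w t (inverse (norm x)) / norm x ^ DIM('a)) \<le> p t x"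
    if t: "0 < t" "t < T" and x: "x \<noteq> 0" and xR: "inverse (norm x) \<ge> 16 * S" for t x
  proof -
    interpret \<mu>: prob_space "\<mu> t" using \<mu> t by simp
    \<comment> \<open>With this \<open>R\<close> the region
      \<open>1/16 \<le> R * norm y \<le> 16\<close> becomes
      \<open>norm x \<le> norm y \<le> 256 * norm x\<close>, which puts \<open>x\<close> on the
      inner sphere, as \<open>shell_mass_le\<close> requires.\<close>
    define R where "R = inverse (norm x) / 16"
    have R: "R \<ge> S" "R > 0" using xR S by (auto simp: R_def)
    have Rx: "norm x = 1 / (16 * R)" using x by (simp add: R_def field_simps)
    define A where "A = {y::'a. norm x \<le> norm y \<and> norm y \<le> 256 * norm x}"
    have [measurable]: "A \<in> sets borel" unfolding A_def by measurable
    have gi: "integrable (\<mu> t) (\<lambda>y. gauss_window (c * norm y))" for c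
      by (rule \<mu>.integrable_const_bound[of _ 1]) (auto simp: gauss_window_nonneg gauss_window_le_1)
    have Ai: "integrable (\<mu> t) (indicator A :: 'a \<Rightarrow> real)"
      by (rule \<mu>.integrable_const_bound[of _ 1]) (auto simp: indicator_def)
    \<comment> \<open>The coefficients are \<open>5 / M^2\<close> and \<open>8 / A^2\<close> at
      \<open>M = A = 16\<close>, for the inner and the outer tail.\<close>
    have "I t R \<le> (\<integral>y. 5 / 256 * gauss_window ((R * 16) * norm y) + 8 / 256 * gauss_window ((R * (1 / 4)) * norm y) + indicator A y \<partial>\<mu> t)"
      unfolding I_def
    proof (rule integral_mono)
      show "integrable (\<mu> t) (\<lambda>y. 5 / 256 * gauss_window ((R * 16) * norm y) + 8 / 256 * gauss_window ((R * (1 / 4)) * norm y) + indicator A y)"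
        by (intro Bochner_Integration.integrable_add integrable_mult_right gi Ai)
      fix y :: 'a
      note n1 = gauss_window_nonneg[of "(R * 16) * norm y"] and n2 = gauss_window_nonneg[of "(R * (1 / 4)) * norm y"]
      consider "norm y < norm x" | "256 * norm x < norm y" | "y \<in> A"
        unfolding A_def using not_le by blast
      then show "gauss_window (R * norm y) \<le> 5 / 256 * gauss_window ((R * 16) * norm y) + 8 / 256 * gauss_window ((R * (1 / 4)) * norm y) + indicator A y"
      proof cases
        case 1
        then have "16 * (R * norm y) \<le> 1" using R by (simp add: Rx field_simps)
        from gauss_window_le_dilated[OF _ _ this] have "gauss_window (R * norm y) \<le> 5 / 256 * gauss_window ((R * 16) * norm y)"
          using R by (simp add: mult_ac)
        moreover have "0 \<le> (indicator A y :: real)" by simp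
        ultimately show ?thesis using n2 by linarith
      next
        case 2
        then have "16 \<le> R * norm y" using R by (simp add: Rx field_simps)
        from gauss_window_le_contracted[OF _ this] have "gauss_window (R * norm y) \<le> 8 / 256 * gauss_window ((R * (1 / 4)) * norm y)"
          by simp
        moreover have "0 \<le> (indicator A y :: real)" by simp
        ultimately show ?thesis using n1 by linarith
      next
        case 3
        then show ?thesis using gauss_window_le_1[of "R * norm y"] n1 n2 by simp
      qed
    qed (rule gi)
    also have "\<dots> = 5 / 256 * I t (R * 16) + 8 / 256 * I t (R * (1 / 4)) + measure (\<mu> t) A"
      unfolding I_def using gi Ai by (simp del: times_divide_eq_right mult_1_right)
    also have "I t (R * 16) \<le> 3 / 2 * ln 2 * (2 * w t R)"
    proof -
      have "I t (R * 16) \<le> 3 / 2 * ln 2 * w t (R * 16)" using I(2)[of t "R * 16"] t T R S R2 by auto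
      also have "\<dots> \<le> 3 / 2 * ln 2 * (2 * w t R)" using up[of t R] t T R S by (intro mult_left_mono) auto
      finally show ?thesis .
    qed
    also have "I t (R * (1 / 4)) \<le> 3 / 2 * ln 2 * (2 * w t R)"
    proof -
      have "I t (R * (1 / 4)) \<le> 3 / 2 * ln 2 * w t (R * (1 / 4))" using I(2)[of t "R * (1 / 4)"] t T R S R2 by auto
      also have "\<dots> \<le> 3 / 2 * ln 2 * (2 * w t R)" using down[of t R] t T R S by (intro mult_left_mono) auto
      finally show ?thesis .
    qed
    \<comment> \<open>The tails cost \<open>(5 + 8) / 256 * (3/2 * 2) = 39/256\<close>. The cutoff
      16 makes this smaller than 1/4, so more than half of the lower bound
      \<open>ln 2 / 2 * w t R\<close> remains for the shell.\<close>
    finally have "I t R \<le> 39 / 256 * (ln 2 * w t R) + measure (\<mu> t) A" by (simp add: algebra_simps)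
    moreover have "ln 2 / 2 * w t R \<le> I t R" using I(1)[of t R] t T R S R2 by auto
    moreover have "0 \<le> ln 2 * w t R" using w_pos[of t R] t R S R2 by simp
    ultimately have "ln 2 / 4 * w t R \<le> measure (\<mu> t) A" by simp
    moreover have "measure (\<mu> t) A \<le> p t x * (V * (256 * norm x) ^ DIM('a))"
      unfolding V_def A_def using t
      by (intro shell_mass_le[OF \<mu> sets_\<mu> p0 _ _ x] dens[folded \<mu>_def] mono) auto
    \<comment> \<open>Back to the scale \<open>R * 16 = 1 / norm x\<close> of the claim.\<close>
    moreover have "ln 2 / 8 * w t (R * 16) \<le> ln 2 / 4 * w t R"
      using up[of t R] t T R S mult_left_mono[of "w t (R * 16)" "2 * w t R" "ln 2 / 8"] by simp
    ultimately have "ln 2 / 8 * w t (R * 16) \<le> p t x * (V * (256 * norm x) ^ DIM('a))" by linarith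
    moreover have "R * 16 = inverse (norm x)" by (simp add: R_def)
    ultimately show ?thesis using V x by (simp add: field_simps power_mult_distrib)
  qed
  define C where "C = max 1 (max (40 * ln 2 / V) (8 * V * 256 ^ DIM('a) / ln 2))"
  have C: "C \<ge> 1" "40 * ln 2 / V \<le> C" "8 * V * 256 ^ DIM('a) / ln 2 \<le> C" by (auto simp: C_def)
  show ?thesis
  \<comment> \<open>The radius encodes \<open>inverse (norm x) \<ge> 16 * S\<close>, the condition
    of \<open>lower\<close> and the stricter of the two.\<close>
  proof (rule exI[of _ "1 / (16 * S)"], rule conjI, use S in simp,
      rule exI[of _ T], rule conjI[OF T(1)], rule exI[of _ C], rule conjI[OF C(1)], intro allI impI)
    fix t and x :: 'a
    assume *: "0 < t \<and> t < T \<and> 0 < norm x \<and> norm x \<le> 1 / (16 * S)"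
    then have x: "x \<noteq> 0" and t: "0 < t" "t < T" by auto
    have xR: "inverse (norm x) \<ge> 16 * S" using * S by (simp add: field_simps)
    define W where "W = w t (inverse (norm x)) / norm x ^ DIM('a)"
    have W0: "W \<ge> 0" using w_pos[of t "inverse (norm x)"] t xR S R2 by (simp add: W_def)
    have Weq: "t / norm x ^ DIM('a) * l (inverse (norm x)) * exp (- (t * radial psi (inverse (norm x)))) = W"
      by (simp add: W_def w_def decay_weight_def f_def)
    have "inverse C \<le> inverse (8 * V * 256 ^ DIM('a) / ln 2)"
      using C(3) V by (intro le_imp_inverse_le) auto
    then have "inverse C * W \<le> ln 2 / (8 * V * 256 ^ DIM('a)) * W"
      using W0 by (intro mult_right_mono) auto
    also have "\<dots> \<le> p t x" unfolding W_def by (rule lower[OF t x xR])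
    finally have 1: "inverse C * W \<le> p t x" .
    have "p t x \<le> 40 * ln 2 / V * W" unfolding W_def using xR S by (intro upper[OF t x]) auto
    also have "\<dots> \<le> C * W" using C(2) W0 by (rule mult_right_mono)
    finally show "inverse C * (t / norm x ^ DIM('a) * l (inverse (norm x))
              * exp (- (t * radial psi (inverse (norm x))))) \<le> p t x \<and>
           p t x \<le> C * (t / norm x ^ DIM('a) * l (inverse (norm x))
              * exp (- (t * radial psi (inverse (norm x)))))"
      unfolding Weq using 1 by blast
  qed
qed

end
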